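(* Let $(M^{0,3},\phi,\xi,\eta,g)$ be a three-dimensional Riemannian Sasakian space-form with $\phi$-sectional curvature $H$. Then a Sasakian quasi-Killing spinor (SqK-spinor) of type $\left(\frac12,\frac{H-1}{4}\right)$ is given by $$\psi=\begin{pmatrix}C_1 \\ C_2\end{pmatrix},\qquad C_1,C_2\in\mathbb{C}\ \text{constants},$$ with respect to an arbitrary Sasakian frame. In particular, on the Berger sphere, that is for $H>-3$, SqK-spinors $\psi^\pm$ of type $\left(\frac{1\pm\sqrt{3+H}}{2},\frac{-2\mp\sqrt{3+H}}{2}\right)$ are given by $$\psi^-=\begin{pmatrix}e^{\frac{\mathrm{i}}{2}\phi}&e^{-\frac{\mathrm{i}}{2}\phi} \\ -e^{\frac{\mathrm{i}}{2}\phi}&e^{-\frac{\mathrm{i}}{2}\phi}\end{pmatrix}\begin{pmatrix}\cos\frac\theta2&-\mathrm{i}\sin\frac\theta2 \\ -\mathrm{i}\sin\frac\theta2&\cos\frac\theta2\end{pmatrix}\begin{pmatrix}e^{\frac{\mathrm{i}}{2}\varphi}&0 \\ 0&e^{-\frac{\mathrm{i}}{2}\varphi}\end{pmatrix}\begin{pmatrix}C_1 \\ C_2\end{pmatrix},$$ $$\psi^+=\xi\cdot\psi^-,\qquad\langle\psi^\pm,\psi^\pm\rangle=2(|C_1|^2+|C_2|^2),\qquad C_1,C_2\in\mathbb{C},$$ with respect to the coordinates $(\theta,\varphi,\phi)$ and the Riemannian Sasakian frame specified in the context. Let $(M^{1,2},\phi,\xi,\eta,g)$ be a three-dimensional Lorentzian-Sasakian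 space-form with $\phi$-sectional curvature $H$. Then an SqK-spinor of type $\left(-\frac12,\frac{H+1}{4}\right)$ is given by $$\psi=\begin{pmatrix}C_1 \\ C_2\end{pmatrix},\qquad C_1,C_2\in\mathbb{C}\ \text{constants},$$ with respect to an arbitrary Sasakian frame. In particular, in the case $H<3$, SqK-spinors $\psi^\pm$ of type $\left(\frac{-1\pm\sqrt{-H+3}}{2},\frac{2\mp\sqrt{-H+3}}{2}\right)$ are given by $$\psi^+=\begin{pmatrix}e^{\frac{\mathrm{i}}{2}\tau}&e^{-\frac{\mathrm{i}}{2}\tau} \\ e^{\frac{\mathrm{i}}{2}\tau}&-e^{-\frac{\mathrm{i}}{2}\tau}\end{pmatrix}\begin{pmatrix}\cosh\frac\chi2&-\mathrm{i}\sinh\frac\chi2 \\ \mathrm{i}\sinh\frac\chi2&\cosh\frac\chi2\end{pmatrix}\begin{pmatrix}e^{\frac{\mathrm{i}}{2}\varphi}&0 \\ 0&e^{-\frac{\mathrm{i}}{2}\varphi}\end{pmatrix}\begin{pmatrix}C_1 \\ C_2\end{pmatrix},$$ $$\psi^-=\xi\cdot\psi^+,\qquad\langle\psi^\pm,\psi^\pm\rangle=2(|C_1|^2-|C_2|^2),\qquad C_1,C_2\in\mathbb{C},$$ with respect to the coordinates $(\chi,\varphi,\tau)$ and the Lorentzian Sasakian frame specified in the context.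
   Context: Write $\mathrm{i}=\sqrt{-1}$; $r=0$ is the Riemannian case and $r=1$ the Lorentzian case. A Sasakian manifold is a contact metric manifold $(M,\phi,\xi,\eta,g)$ with Reeb field $\xi$, $\eta(\xi)=1$, satisfying $R(X,Y)\xi=\eta(Y)X-\eta(X)Y$; Lorentzian-Sasakian manifolds are obtained from Riemannian ones by replacing the metric $g'$ by $g'-2\eta\otimes\eta$, so $g(\xi,\xi)=(-1)^r$. The $\phi$-sectional curvature is $K(X,\phi X)$, $X\perp\xi$; a Sasakian space-form is a simply connected Sasakian manifold with constant $\phi$-sectional curvature $H$. In dimension three there is a global orthonormal frame $e_1=\xi,e_2,e_3$, $g(e_i,e_j)=h_{ij}$, $h=\mathrm{diag}((-1)^r,1,1)$, with $[e_1,e_2]=-\frac{H+(-1)^r3}{2}e_3$, $[e_1,e_3]=\frac{H+(-1)^r3}{2}e_2$, $[e_2,e_3]=-2e_1$, called a Sasakian frame; the dual coframe is $\omega^1=\eta,\omega^2,\omega^3$. Spinors: with respect to a Sasakian frame spinor fields are $\mathbb{C}^2$-valued functions, and $e_j$ acts by Clifford multiplication via $\gamma_1=(-\mathrm{i})^{r-1}\sigma_1$, $\gamma_2=\mathrm{i}\sigma_2$, $\gamma_3=\mathrm{i}\sigma_3$ ($\sigma_j$ the Pauli matrices). The spin connection is $\nabla_X\psi=X(\psi)+\omega^S(X)\psi$ with $\omega^S=\frac{(-\mathrm{i})^r}{2}\sum_j\omega^j\gamma_j+\mathrm{i}^r\frac{H+(-1)^{r-1}}{4}\omega^1\gamma_1$.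 The Spin-invariant form is $\langle\psi_1,\psi_2\rangle=\psi_1^\dagger(\gamma_1)^r\psi_2$. An SqK-spinor of type $(a,b)$, $a,b\in\mathbb{R}$, is a spinor field with $\nabla_X\psi=a\,\mathrm{i}^rX\cdot\psi+b\,\mathrm{i}^r\eta(X)\xi\cdot\psi$ for all $X$. Berger sphere ($r=0$, $H>-3$): with $\alpha>0$, $H=\frac4\alpha-3$, the metric in Hopf-like coordinates $(\theta,\varphi,\phi)$ (here $\phi$ is a coordinate) is $g=\frac\alpha4(d\theta^2+\sin^2\theta\,d\varphi^2)+\frac{\alpha^2}{4}(d\phi+\cos\theta\,d\varphi)^2$, and the Sasakian frame is $e_1=\frac2\alpha\partial_\phi=\xi$, $e_2=\frac{2}{\sqrt\alpha}\left(-\sin\phi\,\partial_\theta+\frac{\cos\phi}{\sin\theta}\partial_\varphi-\cot\theta\cos\phi\,\partial_\phi\right)$, $e_3=\frac{2}{\sqrt\alpha}\left(\cos\phi\,\partial_\theta+\frac{\sin\phi}{\sin\theta}\partial_\varphi-\cot\theta\sin\phi\,\partial_\phi\right)$. Lorentzian space-form of type $\widetilde{SL(2,\mathbb{R})}$ ($r=1$, $H<3$): with $\alpha>0$, $H=-\frac4\alpha+3$, the metric in coordinates $(\chi,\varphi,\tau)$ is $g=\frac\alpha4(d\chi^2+\sinh^2\chi\,d\varphi^2)-\frac{\alpha^2}{4}(d\tau+\cosh\chi\,d\varphi)^2$, and the Sasakian frame is $e_1=\frac2\alpha\partial_\tau=\xi$, $e_2=\frac{2}{\sqrt\alpha}\left(\cos\tau\,\partial_\chi+\frac{\sin\tau}{\sinh\chi}\partial_\varphi-\coth\chi\sin\tau\,\partial_\tau\right)$,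 $e_3=\frac{2}{\sqrt\alpha}\left(-\sin\tau\,\partial_\chi+\frac{\cos\tau}{\sinh\chi}\partial_\varphi-\coth\chi\cos\tau\,\partial_\tau\right)$. *)

theory Defs
  imports "HOL-Analysis.Analysis"
begin

section \<open>Smooth three-manifolds\<close>

text \<open>
  A manifold is a Hausdorff second countable type \<open>'a\<close> together with a smooth structure, i.e. a
  maximal smooth atlas. In a chart \<open>(U, x)\<close> only the values of \<open>x\<close> on \<open>U\<close> matter.
\<close>

definition partial :: "3 \<Rightarrow> (real^3 \<Rightarrow> real) \<Rightarrow> real^3 \<Rightarrow> real" where
  "partial k f y = frechet_derivative f (at y) (axis k 1)"

primrec Ck_on :: "nat \<Rightarrow> (real^3) set \<Rightarrow> (real^3 \<Rightarrow> real) \<Rightarrow> bool" where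
  "Ck_on 0 S f \<longleftrightarrow> continuous_on S f"
| "Ck_on (Suc n) S f \<longleftrightarrow> (\<forall>y\<in>S. f differentiable (at y)) \<and> (\<forall>k. Ck_on n S (partial k f))"

definition Cinf_on :: "(real^3) set \<Rightarrow> (real^3 \<Rightarrow> real) \<Rightarrow> bool" where
  "Cinf_on S f \<longleftrightarrow> (\<forall>n. Ck_on n S f)"

type_synonym 'a chart = "'a set \<times> ('a \<Rightarrow> real^3)"
type_synonym 'a atlas = "'a chart set"

definition is_chart :: "'a::topological_space chart \<Rightarrow> bool" where
  "is_chart = (\<lambda>(U, x). open U \<and> open (x ` U) \<and>
     homeomorphism U (x ` U) x (inv_into U x))"

definition smooth_transition :: "'a chart \<Rightarrow> 'a chart \<Rightarrow> bool" where
  "smooth_transition = (\<lambda>(U, x) (V, y).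
     \<forall>k. Cinf_on (x ` (U \<inter> V)) (\<lambda>z. y (inv_into U x z) $ k))"

definition smooth_structure :: "'a::topological_space atlas \<Rightarrow> bool" where
  "smooth_structure A \<longleftrightarrow>
     (\<forall>c\<in>A. is_chart c) \<and> (\<Union>c\<in>A. fst c) = UNIV \<and>
     (\<forall>c\<in>A. \<forall>d\<in>A. smooth_transition c d) \<and>
     (\<forall>c. is_chart c \<and> (\<forall>d\<in>A. smooth_transition c d \<and> smooth_transition d c) \<longrightarrow> c \<in> A)"

text \<open>Smoothness of a function on a neighbourhood of \<open>p\<close>.\<close>

definition smooth_near :: "'a::topological_space atlas \<Rightarrow> 'a \<Rightarrow> ('a \<Rightarrow> real) \<Rightarrow> bool" where
  "smooth_near A p f \<longleftrightarrow> (\<exists>(U, x)\<in>A. \<exists>V. open V \<and> p \<in> V \<and> V \<subseteq> U \<and>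
     Cinf_on (x ` V) (\<lambda>z. f (inv_into U x z)))"

definition smooth_fun_on :: "'a::topological_space atlas \<Rightarrow> 'a set \<Rightarrow> ('a \<Rightarrow> real) \<Rightarrow> bool" where
  "smooth_fun_on A S f \<longleftrightarrow> (\<forall>p\<in>S. smooth_near A p f)"

text \<open>
  A tangent vector at \<open>p\<close> is a derivation of the algebra of functions that are smooth near \<open>p\<close>
  (it depends only on the germ of the function at \<open>p\<close>). It is normalised to be \<open>0\<close> on all other
  functions, so that two tangent vectors are equal iff they agree as derivations.
\<close>

type_synonym 'a tvec = "('a \<Rightarrow> real) \<Rightarrow> real"
type_synonym 'a vfield = "'a \<Rightarrow> 'a tvec"

definition tangent_space :: "'a::topological_space atlas \<Rightarrow> 'a \<Rightarrow> 'a tvec set" where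
  "tangent_space A p = {v.
     (\<forall>f. \<not> smooth_near A p f \<longrightarrow> v f = 0) \<and>
     (\<forall>f h c. smooth_near A p f \<and> smooth_near A p h \<longrightarrow>
        v (\<lambda>q. c * f q + h q) = c * v f + v h \<and>
        v (\<lambda>q. f q * h q) = f p * v h + h p * v f)}"

definition vector_field :: "'a::topological_space atlas \<Rightarrow> 'a vfield \<Rightarrow> bool" where
  "vector_field A X \<longleftrightarrow> (\<forall>p. X p \<in> tangent_space A p) \<and>
     (\<forall>S f. open S \<and> smooth_fun_on A S f \<longrightarrow> smooth_fun_on A S (\<lambda>p. X p f))"

definition lie_bracket ::
    "'a::topological_space atlas \<Rightarrow> 'a vfield \<Rightarrow> 'a vfield \<Rightarrow> 'a vfield" where
  "lie_bracket A X Y = (\<lambda>p f.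
     if smooth_near A p f then X p (\<lambda>q. Y q f) - Y p (\<lambda>q. X q f) else 0)"

definition coord_vector ::
    "'a::topological_space atlas \<Rightarrow> 'a chart \<Rightarrow> 3 \<Rightarrow> 'a vfield" where
  "coord_vector A = (\<lambda>(U, x) k p f.
     if smooth_near A p f then partial k (\<lambda>z. f (inv_into U x z)) (x p) else 0)"


section \<open>Metrics, connections, curvature\<close>

type_synonym 'a form1 = "'a \<Rightarrow> 'a tvec \<Rightarrow> real"
type_synonym 'a form2 = "'a \<Rightarrow> 'a tvec \<Rightarrow> 'a tvec \<Rightarrow> real"
type_synonym 'a endo = "'a \<Rightarrow> 'a tvec \<Rightarrow> 'a tvec"
type_synonym 'a connection = "'a vfield \<Rightarrow> 'a vfield \<Rightarrow> 'a vfield"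

definition one_form :: "'a::topological_space atlas \<Rightarrow> 'a form1 \<Rightarrow> bool" where
  "one_form A \<eta> \<longleftrightarrow>
     (\<forall>p. \<forall>v\<in>tangent_space A p. \<forall>w\<in>tangent_space A p. \<forall>c.
        \<eta> p (\<lambda>f. c * v f + w f) = c * \<eta> p v + \<eta> p w) \<and>
     (\<forall>X. vector_field A X \<longrightarrow> smooth_fun_on A UNIV (\<lambda>p. \<eta> p (X p)))"

definition endomorphism_field :: "'a::topological_space atlas \<Rightarrow> 'a endo \<Rightarrow> bool" where
  "endomorphism_field A \<phi> \<longleftrightarrow>
     (\<forall>p. \<forall>v\<in>tangent_space A p. \<phi> p v \<in> tangent_space A p) \<and>
     (\<forall>p. \<forall>v\<in>tangent_space A p. \<forall>w\<in>tangent_space A p. \<forall>c.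
        \<phi> p (\<lambda>f. c * v f + w f) = (\<lambda>f. c * \<phi> p v f + \<phi> p w f)) \<and>
     (\<forall>X. vector_field A X \<longrightarrow> vector_field A (\<lambda>p. \<phi> p (X p)))"

definition riemannian_metric :: "'a::topological_space atlas \<Rightarrow> 'a form2 \<Rightarrow> bool" where
  "riemannian_metric A g \<longleftrightarrow>
     (\<forall>p. \<forall>u\<in>tangent_space A p. \<forall>v\<in>tangent_space A p. \<forall>w\<in>tangent_space A p. \<forall>c.
        g p (\<lambda>f. c * u f + v f) w = c * g p u w + g p v w) \<and>
     (\<forall>p. \<forall>v\<in>tangent_space A p. \<forall>w\<in>tangent_space A p. g p v w = g p w v) \<and>
     (\<forall>p. \<forall>v\<in>tangent_space A p. v \<noteq> (\<lambda>f. 0) \<longrightarrow> g p v v > 0) \<and>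
     (\<forall>X Y. vector_field A X \<and> vector_field A Y \<longrightarrow>
        smooth_fun_on A UNIV (\<lambda>p. g p (X p) (Y p)))"

text \<open>
  The Levi-Civita connection of a pseudo-Riemannian metric, as an operator on global vector fields
  (on which it is unique).
\<close>

definition levi_civita ::
    "'a::topological_space atlas \<Rightarrow> 'a form2 \<Rightarrow> 'a connection \<Rightarrow> bool" where
  "levi_civita A g D \<longleftrightarrow>
     (\<forall>X Y. vector_field A X \<and> vector_field A Y \<longrightarrow> vector_field A (D X Y)) \<and>
     (\<forall>X X' Y h. vector_field A X \<and> vector_field A X' \<and> vector_field A Y \<and>
        smooth_fun_on A UNIV h \<longrightarrow>
        D (\<lambda>p f. h p * X p f + X' p f) Y = (\<lambda>p f. h p * D X Y p f + D X' Y p f)) \<and>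
     (\<forall>X Y Y' h. vector_field A X \<and> vector_field A Y \<and> vector_field A Y' \<and>
        smooth_fun_on A UNIV h \<longrightarrow>
        D X (\<lambda>p f. h p * Y p f + Y' p f) =
          (\<lambda>p f. X p h * Y p f + h p * D X Y p f + D X Y' p f)) \<and>
     (\<forall>X Y. vector_field A X \<and> vector_field A Y \<longrightarrow>
        (\<lambda>p f. D X Y p f - D Y X p f) = lie_bracket A X Y) \<and>
     (\<forall>X Y Z p. vector_field A X \<and> vector_field A Y \<and> vector_field A Z \<longrightarrow>
        X p (\<lambda>q. g q (Y q) (Z q)) = g p (D X Y p) (Z p) + g p (Y p) (D X Z p))"

definition curvature :: "'a::topological_space atlas \<Rightarrow> 'a connection \<Rightarrow>
    'a vfield \<Rightarrow> 'a vfield \<Rightarrow> 'a vfield \<Rightarrow> 'a vfield" where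
  "curvature A D X Y Z = (\<lambda>p f.
     D X (D Y Z) p f - D Y (D X Z) p f - D (lie_bracket A X Y) Z p f)"

definition sectional_curvature :: "'a::topological_space atlas \<Rightarrow> 'a form2 \<Rightarrow> 'a connection \<Rightarrow>
    'a vfield \<Rightarrow> 'a vfield \<Rightarrow> 'a \<Rightarrow> real" where
  "sectional_curvature A g D X Y p =
     g p (curvature A D X Y Y p) (X p) /
     (g p (X p) (X p) * g p (Y p) (Y p) - (g p (X p) (Y p))\<^sup>2)"


section \<open>Sasakian structures\<close>

text \<open>
  The exterior derivative carries the factor 1/2, as in Blair's conventions; this is the normalisation
  compatible with the curvature condition below and with \<open>[e\<^sub>2, e\<^sub>3] = -2 e\<^sub>1\<close> in a Sasakian frame.
\<close>

definition ext_deriv :: "'a::topological_space atlas \<Rightarrow> 'a form1 \<Rightarrow>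
    'a vfield \<Rightarrow> 'a vfield \<Rightarrow> 'a \<Rightarrow> real" where
  "ext_deriv A \<eta> X Y p =
     (X p (\<lambda>q. \<eta> q (Y q)) - Y p (\<lambda>q. \<eta> q (X q)) - \<eta> p (lie_bracket A X Y p)) / 2"

text \<open>Nondegeneracy of \<open>\<eta> \<and> d\<eta>\<close> follows from the last three conditions.\<close>

definition contact_metric :: "'a::topological_space atlas \<Rightarrow> 'a endo \<Rightarrow> 'a vfield \<Rightarrow>
    'a form1 \<Rightarrow> 'a form2 \<Rightarrow> bool" where
  "contact_metric A \<phi> \<xi> \<eta> g \<longleftrightarrow>
     smooth_structure A \<and> riemannian_metric A g \<and>
     endomorphism_field A \<phi> \<and> vector_field A \<xi> \<and> one_form A \<eta> \<and>
     (\<forall>p. \<eta> p (\<xi> p) = 1) \<and>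
     (\<forall>p. \<forall>v\<in>tangent_space A p. \<phi> p (\<phi> p v) = (\<lambda>f. - v f + \<eta> p v * \<xi> p f)) \<and>
     (\<forall>p. \<forall>v\<in>tangent_space A p. \<forall>w\<in>tangent_space A p.
        g p (\<phi> p v) (\<phi> p w) = g p v w - \<eta> p v * \<eta> p w) \<and>
     (\<forall>X Y p. vector_field A X \<and> vector_field A Y \<longrightarrow>
        ext_deriv A \<eta> X Y p = g p (X p) (\<phi> p (Y p)))"

definition sasakian :: "'a::topological_space atlas \<Rightarrow> 'a endo \<Rightarrow> 'a vfield \<Rightarrow>
    'a form1 \<Rightarrow> 'a form2 \<Rightarrow> bool" where
  "sasakian A \<phi> \<xi> \<eta> g \<longleftrightarrow> contact_metric A \<phi> \<xi> \<eta> g \<and>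
     (\<exists>D. levi_civita A g D \<and>
       (\<forall>X Y. vector_field A X \<and> vector_field A Y \<longrightarrow>
          curvature A D X Y \<xi> = (\<lambda>p f. \<eta> p (Y p) * X p f - \<eta> p (X p) * Y p f)))"

text \<open>
  \<open>g = g' - 2 \<eta> \<otimes> \<eta>\<close> with \<open>g'\<close> the metric of a Riemannian Sasakian structure.
\<close>

definition lorentzian_sasakian :: "'a::topological_space atlas \<Rightarrow> 'a endo \<Rightarrow> 'a vfield \<Rightarrow>
    'a form1 \<Rightarrow> 'a form2 \<Rightarrow> bool" where
  "lorentzian_sasakian A \<phi> \<xi> \<eta> g \<longleftrightarrow>
     sasakian A \<phi> \<xi> \<eta> (\<lambda>p v w. g p v w + 2 * \<eta> p v * \<eta> p w)"

definition phi_sectional_curvature :: "'a::topological_space atlas \<Rightarrow> 'a endo \<Rightarrow> 'a vfield \<Rightarrow>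
    'a form2 \<Rightarrow> real \<Rightarrow> bool" where
  "phi_sectional_curvature A \<phi> \<xi> g H \<longleftrightarrow>
     (\<exists>D. levi_civita A g D \<and>
       (\<forall>X p. vector_field A X \<and> X p \<noteq> (\<lambda>f. 0) \<and> g p (X p) (\<xi> p) = 0 \<longrightarrow>
          sectional_curvature A g D X (\<lambda>q. \<phi> q (X q)) p = H))"

definition sasakian_space_form ::
    "'a::{t2_space,second_countable_topology} atlas \<Rightarrow> 'a endo \<Rightarrow> 'a vfield \<Rightarrow>
    'a form1 \<Rightarrow> 'a form2 \<Rightarrow> real \<Rightarrow> bool" where
  "sasakian_space_form A \<phi> \<xi> \<eta> g H \<longleftrightarrow>
     simply_connected (UNIV :: 'a set) \<and> sasakian A \<phi> \<xi> \<eta> g \<and>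
     phi_sectional_curvature A \<phi> \<xi> g H"

definition lorentzian_sasakian_space_form ::
    "'a::{t2_space,second_countable_topology} atlas \<Rightarrow> 'a endo \<Rightarrow> 'a vfield \<Rightarrow>
    'a form1 \<Rightarrow> 'a form2 \<Rightarrow> real \<Rightarrow> bool" where
  "lorentzian_sasakian_space_form A \<phi> \<xi> \<eta> g H \<longleftrightarrow>
     simply_connected (UNIV :: 'a set) \<and> lorentzian_sasakian A \<phi> \<xi> \<eta> g \<and>
     phi_sectional_curvature A \<phi> \<xi> g H"

text \<open>
  \<open>r = 0\<close> is the Riemannian and \<open>r = 1\<close> the Lorentzian case. Note \<open>3 = (0 :: 3)\<close> in the index type.
\<close>

definition sasakian_frame :: "nat \<Rightarrow> 'a::topological_space atlas \<Rightarrow> 'a vfield \<Rightarrow>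
    'a form2 \<Rightarrow> real \<Rightarrow> (3 \<Rightarrow> 'a vfield) \<Rightarrow> bool" where
  "sasakian_frame r A \<xi> g H e \<longleftrightarrow>
     (\<forall>j. vector_field A (e j)) \<and>
     (\<forall>p. \<forall>v\<in>tangent_space A p. \<exists>!c :: real^3. v = (\<lambda>f. \<Sum>j\<in>UNIV. c $ j * e j p f)) \<and>
     e 1 = \<xi> \<and>
     (\<forall>p i j. g p (e i p) (e j p) = (if i \<noteq> j then 0 else if i = 1 then (-1) ^ r else 1)) \<and>
     lie_bracket A (e 1) (e 2) = (\<lambda>p f. - ((H + (-1) ^ r * 3) / 2) * e 3 p f) \<and>
     lie_bracket A (e 1) (e 3) = (\<lambda>p f. (H + (-1) ^ r * 3) / 2 * e 2 p f) \<and>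
     lie_bracket A (e 2) (e 3) = (\<lambda>p f. - 2 * e 1 p f)"

text \<open>The dual coframe: \<open>coframe e j p v\<close> is \<open>\<omega>\<^sup>j(v)\<close>.\<close>

definition coframe :: "(3 \<Rightarrow> 'a vfield) \<Rightarrow> 3 \<Rightarrow> 'a form1" where
  "coframe e j p v = (THE c :: real^3. v = (\<lambda>f. \<Sum>k\<in>UNIV. c $ k * e k p f)) $ j"


section \<open>Spinors with respect to a Sasakian frame\<close>

definition pauli :: "3 \<Rightarrow> complex^2^2" where
  "pauli j = (if j = 1 then vector [vector [0, 1], vector [1, 0]]
     else if j = 2 then vector [vector [0, - \<i>], vector [\<i>, 0]]
     else vector [vector [1, 0], vector [0, - 1]])"

definition gam :: "nat \<Rightarrow> 3 \<Rightarrow> complex^2^2" where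
  "gam r j = (if j = 1 then mat ((- \<i>) powi (int r - 1)) ** pauli 1 else mat \<i> ** pauli j)"

text \<open>The Clifford product \<open>v \<cdot> s\<close> of a tangent vector \<open>v\<close> at \<open>p\<close> and a spinor \<open>s\<close>.\<close>

definition clifford :: "nat \<Rightarrow> (3 \<Rightarrow> 'a vfield) \<Rightarrow> 'a \<Rightarrow> 'a tvec \<Rightarrow> complex^2 \<Rightarrow> complex^2" where
  "clifford r e p v s = (\<Sum>j\<in>UNIV. complex_of_real (coframe e j p v) *s (gam r j *v s))"

definition spin_form :: "nat \<Rightarrow> (3 \<Rightarrow> 'a vfield) \<Rightarrow> real \<Rightarrow> 'a \<Rightarrow> 'a tvec \<Rightarrow> complex^2^2" where
  "spin_form r e H p v =
     mat ((- \<i>) ^ r / 2) ** (\<Sum>j\<in>UNIV. mat (complex_of_real (coframe e j p v)) ** gam r j) +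
     mat (\<i> ^ r * ((complex_of_real H + (- 1) powi (int r - 1)) / 4) *
          complex_of_real (coframe e 1 p v)) ** gam r 1"

definition spinor_field_on ::
    "'a::topological_space atlas \<Rightarrow> 'a set \<Rightarrow> ('a \<Rightarrow> complex^2) \<Rightarrow> bool" where
  "spinor_field_on A S \<psi> \<longleftrightarrow>
     (\<forall>i. smooth_fun_on A S (\<lambda>q. Re (\<psi> q $ i)) \<and> smooth_fun_on A S (\<lambda>q. Im (\<psi> q $ i)))"

definition dir_deriv :: "'a tvec \<Rightarrow> ('a \<Rightarrow> complex^2) \<Rightarrow> complex^2" where
  "dir_deriv v \<psi> = (\<chi> i. Complex (v (\<lambda>q. Re (\<psi> q $ i))) (v (\<lambda>q. Im (\<psi> q $ i))))"

definition spin_connection :: "nat \<Rightarrow> (3 \<Rightarrow> 'a vfield) \<Rightarrow> real \<Rightarrow>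
    'a \<Rightarrow> 'a tvec \<Rightarrow> ('a \<Rightarrow> complex^2) \<Rightarrow> complex^2" where
  "spin_connection r e H p v \<psi> = dir_deriv v \<psi> + spin_form r e H p v *v \<psi> p"

text \<open>\<open>sqk_spinor_on r A \<xi> \<eta> H e S a b \<psi>\<close>: on the open set \<open>S\<close>, \<open>\<psi>\<close> is an SqK-spinor of type \<open>(a, b)\<close>.\<close>

definition sqk_spinor_on :: "nat \<Rightarrow> 'a::topological_space atlas \<Rightarrow> 'a vfield \<Rightarrow> 'a form1 \<Rightarrow>
    real \<Rightarrow> (3 \<Rightarrow> 'a vfield) \<Rightarrow> 'a set \<Rightarrow> real \<Rightarrow> real \<Rightarrow> ('a \<Rightarrow> complex^2) \<Rightarrow> bool" where
  "sqk_spinor_on r A \<xi> \<eta> H e S a b \<psi> \<longleftrightarrow>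
     spinor_field_on A S \<psi> \<and>
     (\<forall>p\<in>S. \<forall>v\<in>tangent_space A p.
        spin_connection r e H p v \<psi> =
          (complex_of_real a * \<i> ^ r) *s clifford r e p v (\<psi> p) +
          (complex_of_real b * \<i> ^ r * complex_of_real (\<eta> p v)) *s clifford r e p (\<xi> p) (\<psi> p))"

text \<open>The Spin-invariant form \<open>\<psi>\<^sub>1\<^sup>\<dagger> \<gamma>\<^sub>1\<^sup>r \<psi>\<^sub>2\<close>; \<open>^^\<close> iterates the action of the matrix \<open>\<gamma>\<^sub>1\<close>.\<close>

definition spin_inner :: "nat \<Rightarrow> complex^2 \<Rightarrow> complex^2 \<Rightarrow> complex" where
  "spin_inner r s t = (\<Sum>i\<in>UNIV. cnj (s $ i) * ((((*v) (gam r 1)) ^^ r) t) $ i)"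


section \<open>Coordinates on the space-forms\<close>

text \<open>
  \<open>c = (U, x)\<close> is a chart with coordinates \<open>(\<theta>, \<varphi>, \<phi>)\<close> in which the metric and the Sasakian frame
  are those of the Berger sphere; \<open>d k v\<close> is the \<open>k\<close>-th coordinate differential of \<open>v\<close>, \<open>D k\<close> the
  \<open>k\<close>-th coordinate vector.
  The angles \<open>\<varphi>, \<phi>\<close> may be taken in any branch.
\<close>

definition berger_coordinates :: "'a::topological_space atlas \<Rightarrow> 'a form2 \<Rightarrow> (3 \<Rightarrow> 'a vfield) \<Rightarrow>
    real \<Rightarrow> 'a chart \<Rightarrow> bool" where
  "berger_coordinates A g e \<alpha> c \<longleftrightarrow> c \<in> A \<and>
     (\<forall>p\<in>fst c.
       let \<theta> = snd c p $ 1; \<phi> = snd c p $ 3;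
           d = (\<lambda>k (v :: 'a tvec). v (\<lambda>q. snd c q $ k));
           D = (\<lambda>k. coord_vector A c k p)
       in 0 < \<theta> \<and> \<theta> < pi \<and>
          (\<forall>v\<in>tangent_space A p. \<forall>w\<in>tangent_space A p.
             g p v w = \<alpha> / 4 * (d 1 v * d 1 w + (sin \<theta>)\<^sup>2 * (d 2 v * d 2 w)) +
               \<alpha>\<^sup>2 / 4 * ((d 3 v + cos \<theta> * d 2 v) * (d 3 w + cos \<theta> * d 2 w))) \<and>
          e 1 p = (\<lambda>f. 2 / \<alpha> * D 3 f) \<and>
          e 2 p = (\<lambda>f. 2 / sqrt \<alpha> *
            (- sin \<phi> * D 1 f + cos \<phi> / sin \<theta> * D 2 f - cot \<theta> * cos \<phi> * D 3 f)) \<and>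
          e 3 p = (\<lambda>f. 2 / sqrt \<alpha> *
            (cos \<phi> * D 1 f + sin \<phi> / sin \<theta> * D 2 f - cot \<theta> * sin \<phi> * D 3 f)))"

text \<open>The same with coordinates \<open>(\<chi>, \<varphi>, \<tau>)\<close> for the Lorentzian space-form of type \<open>SL(2, R)\<close>.\<close>

definition lorentz_coordinates :: "'a::topological_space atlas \<Rightarrow> 'a form2 \<Rightarrow> (3 \<Rightarrow> 'a vfield) \<Rightarrow>
    real \<Rightarrow> 'a chart \<Rightarrow> bool" where
  "lorentz_coordinates A g e \<alpha> c \<longleftrightarrow> c \<in> A \<and>
     (\<forall>p\<in>fst c.
       let x = snd c p $ 1; \<tau> = snd c p $ 3;
           d = (\<lambda>k (v :: 'a tvec). v (\<lambda>q. snd c q $ k));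
           D = (\<lambda>k. coord_vector A c k p)
       in 0 < x \<and>
          (\<forall>v\<in>tangent_space A p. \<forall>w\<in>tangent_space A p.
             g p v w = \<alpha> / 4 * (d 1 v * d 1 w + (sinh x)\<^sup>2 * (d 2 v * d 2 w)) -
               \<alpha>\<^sup>2 / 4 * ((d 3 v + cosh x * d 2 v) * (d 3 w + cosh x * d 2 w))) \<and>
          e 1 p = (\<lambda>f. 2 / \<alpha> * D 3 f) \<and>
          e 2 p = (\<lambda>f. 2 / sqrt \<alpha> *
            (cos \<tau> * D 1 f + sin \<tau> / sinh x * D 2 f - cosh x / sinh x * sin \<tau> * D 3 f)) \<and>
          e 3 p = (\<lambda>f. 2 / sqrt \<alpha> *
            (- sin \<tau> * D 1 f + cos \<tau> / sinh x * D 2 f - cosh x / sinh x * cos \<tau> * D 3 f)))"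

text \<open>\<open>half_cis t\<close> is \<open>exp (\<i> t / 2)\<close>. The argument \<open>y\<close> below is the coordinate triple.\<close>

definition half_cis :: "real \<Rightarrow> complex" where
  "half_cis t = exp (\<i> / 2 * complex_of_real t)"

definition berger_spinor :: "real^3 \<Rightarrow> complex^2 \<Rightarrow> complex^2" where
  "berger_spinor y C =
     (vector [vector [half_cis (y $ 3), half_cis (- (y $ 3))],
              vector [- half_cis (y $ 3), half_cis (- (y $ 3))]] :: complex^2^2) *v
     ((vector [vector [complex_of_real (cos (y $ 1 / 2)), - \<i> * complex_of_real (sin (y $ 1 / 2))],
               vector [- \<i> * complex_of_real (sin (y $ 1 / 2)), complex_of_real (cos (y $ 1 / 2))]]
        :: complex^2^2) *v
     ((vector [vector [half_cis (y $ 2), 0],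
               vector [0, half_cis (- (y $ 2))]] :: complex^2^2) *v C))"

definition lorentz_spinor :: "real^3 \<Rightarrow> complex^2 \<Rightarrow> complex^2" where
  "lorentz_spinor y C =
     (vector [vector [half_cis (y $ 3), half_cis (- (y $ 3))],
              vector [half_cis (y $ 3), - half_cis (- (y $ 3))]] :: complex^2^2) *v
     ((vector [vector [complex_of_real (cosh (y $ 1 / 2)), - \<i> * complex_of_real (sinh (y $ 1 / 2))],
               vector [\<i> * complex_of_real (sinh (y $ 1 / 2)), complex_of_real (cosh (y $ 1 / 2))]]
        :: complex^2^2) *v
     ((vector [vector [half_cis (y $ 2), 0],
               vector [0, half_cis (- (y $ 2))]] :: complex^2^2) *v C))"

end

theory Submission
  imports Defs
begin

text \<open>
  Both sides of the SqK equation are linear in the tangent vector, so it suffices to check it on the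
  Sasakian frame. Since \<open>\<eta>(\<xi>) = 1\<close> and \<open>\<eta>(e\<^sub>2) = \<eta>(e\<^sub>3) = 0\<close>, it becomes \<open>e\<^sub>1 \<psi> = l \<gamma>\<^sub>1 \<psi>\<close> and
  \<open>e\<^sub>j \<psi> = k \<gamma>\<^sub>j \<psi>\<close> for \<open>j = 2, 3\<close>, with constants \<open>k, l\<close> determined by the type and \<open>H\<close>. For the types of
  the constant spinors, \<open>k = l = 0\<close>. The coordinate spinors are products of one-parameter groups in the
  three coordinates, so their coordinate derivatives are explicit, and rotating the half angles back gives
  the required eigenvalue equations. Finally \<open>\<gamma>\<^sub>1\<close> anticommutes with \<open>\<gamma>\<^sub>2, \<gamma>\<^sub>3\<close>, so Clifford
  multiplication by \<open>\<xi>\<close> keeps \<open>l\<close> and changes the sign of \<open>k\<close>, which exchanges the two types.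
\<close>

section \<open>Smooth functions\<close>

lemma partial_eqI: "(f has_derivative f') (at y) \<Longrightarrow> partial k f y = f' (axis k 1)"
  using frechet_derivative_at[of f f' y] by (simp add: partial_def)

lemma partial_cong:
  assumes "open S" "y \<in> S" "\<And>z. z \<in> S \<Longrightarrow> f z = g z"
  shows "partial k f y = partial k g y"
proof -
  have "(f has_derivative D) (at y) \<longleftrightarrow> (g has_derivative D) (at y)" for D
    using assms has_derivative_transform_within_open[of f D y UNIV S g]
      has_derivative_transform_within_open[of g D y UNIV S f] by auto
  then show ?thesis by (simp add: partial_def frechet_derivative_def)
qed

text \<open>Since \<open>S\<close> is open, derivatives at a point of \<open>S\<close> depend only
  on values inside \<open>S\<close>. Derivative formulas that hold pointwise on \<open>S\<close> can
  therefore replace \<open>partial k f\<close> in the recursion.\<close>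

lemma Ck_on_cong:
  assumes "open S" "\<And>z. z \<in> S \<Longrightarrow> f z = g z" "Ck_on n S f"
  shows "Ck_on n S g"
  using assms(2,3)
proof (induction n arbitrary: f g)
  case 0
  then show ?case by (simp cong: continuous_on_cong)
next
  case (Suc n)
  have "g differentiable (at y)" if "y \<in> S" for y
  proof -
    from Suc.prems that obtain D where "(f has_derivative D) (at y)"
      by (auto simp: differentiable_def)
    with has_derivative_transform_within_open[OF this assms(1) that, of g] Suc.prems(1)
    show ?thesis unfolding differentiable_def by blast
  qed
  moreover have "Ck_on n S (partial k g)" for k
  proof (rule Suc.IH[of "partial k f"])
    show "partial k f z = partial k g z" if "z \<in> S" for z
      using partial_cong[OF assms(1) that Suc.prems(1)] .
    show "Ck_on n S (partial k f)" using Suc.prems(2) by simp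
  qed
  ultimately show ?case by simp
qed

text \<open>Needed for the product rule, where each factor also occurs undifferentiated and must be
  known to have the lower order of smoothness.\<close>

lemma Ck_on_Suc_imp: "Ck_on (Suc n) S f \<Longrightarrow> Ck_on n S f"
proof (induction n arbitrary: f)
  case 0
  then show ?case
    by (auto intro!: continuous_at_imp_continuous_on differentiable_imp_continuous_within)
next
  case (Suc n)
  from Suc.prems have "\<forall>y\<in>S. f differentiable at y" "\<And>k. Ck_on (Suc n) S (partial k f)"
    by simp_all
  with Suc.IH show ?case by simp
qed

lemma Ck_on_const: "Ck_on n S (\<lambda>_. c)"
proof (induction n arbitrary: c)
  case (Suc n)
  have "partial k (\<lambda>_. c) = (\<lambda>_. 0)" for k
    by (auto intro!: ext partial_eqI derivative_eq_intros)
  with Suc show ?case by simp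
qed simp

lemma Ck_on_add:
  assumes "open S" "Ck_on n S f" "Ck_on n S g"
  shows "Ck_on n S (\<lambda>y. f y + g y)"
  using assms(2,3)
proof (induction n arbitrary: f g)
  case 0
  then show ?case by (simp add: continuous_on_add)
next
  case (Suc n)
  have "partial k (\<lambda>y. f y + g y) y = partial k f y + partial k g y" if "y \<in> S" for k y
    using Suc.prems that
    by (auto simp: partial_def frechet_derivative_works intro!: partial_eqI[unfolded partial_def]
        derivative_eq_intros)
  moreover have "Ck_on n S (\<lambda>y. partial k f y + partial k g y)" for k
    using Suc.prems by (intro Suc.IH) simp_all
  ultimately have "Ck_on n S (partial k (\<lambda>y. f y + g y))" for k
    using Ck_on_cong[OF assms(1), of "\<lambda>y. partial k f y + partial k g y"] by metis
  with Suc.prems show ?case by simp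
qed

lemma Ck_on_mult:
  assumes "open S" "Ck_on n S f" "Ck_on n S g"
  shows "Ck_on n S (\<lambda>y. f y * g y)"
  using assms(2,3)
proof (induction n arbitrary: f g)
  case 0
  then show ?case by (simp add: continuous_on_mult)
next
  case (Suc n)
  have *: "partial k (\<lambda>y. f y * g y) y = f y * partial k g y + partial k f y * g y"
    if "y \<in> S" for k y
    using Suc.prems that
    by (auto simp: partial_def frechet_derivative_works intro!: partial_eqI[unfolded partial_def]
        derivative_eq_intros)
  have "Ck_on n S (\<lambda>y. f y * partial k g y + partial k f y * g y)" for k
    using Suc.prems Ck_on_Suc_imp[OF Suc.prems(1)] Ck_on_Suc_imp[OF Suc.prems(2)]
    by (intro Ck_on_add[OF assms(1)] Suc.IH) simp_all
  then have "Ck_on n S (partial k (\<lambda>y. f y * g y))" for k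
    by (rule Ck_on_cong[OF assms(1), rotated]) (use * in simp)
  with Suc.prems show ?case by simp
qed

text \<open>A sequence \<open>h\<close> in which each member differentiates to the next makes the
  induction close: every partial derivative is a constant times the next member. The scale
  \<open>a\<close> serves the half angles.\<close>

lemma Ck_on_coordinate_fun:
  fixes h :: "nat \<Rightarrow> real \<Rightarrow> real"
  assumes "open S" "\<And>m t. (h m has_real_derivative h (Suc m) t) (at t)"
  shows "Ck_on n S (\<lambda>y. h m (a * y $ k))"
proof -
  have D: "((\<lambda>y. h m (a * y $ k)) has_derivative (\<lambda>v. h (Suc m) (a * y $ k) * (a * v $ k))) (at y)"
    for m and y :: "real^3"
  proof -
    have "((\<lambda>y. a * y $ k) has_derivative (\<lambda>v. a * v $ k)) (at y)"
      by (intro has_derivative_mult_right bounded_linear_imp_has_derivative bounded_linear_vec_nth)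
    from has_derivative_compose[OF this assms(2)[unfolded has_field_derivative_def]] show ?thesis .
  qed
  show ?thesis
  proof (induction n arbitrary: m)
    case 0
    show ?case
      using has_derivative_continuous[OF D] by (simp add: continuous_at_imp_continuous_on)
  next
    case (Suc n)
    have "partial j (\<lambda>y. h m (a * y $ k)) = (\<lambda>y. (a * axis j 1 $ k) * h (Suc m) (a * y $ k))" for j
      by (rule ext) (subst partial_eqI[OF D], simp)
    with D show ?case
      using Ck_on_mult[OF assms(1) Ck_on_const Suc.IH] by (auto simp: differentiable_def)
  qed
qed

lemma Cinf_on_trig:
  assumes "open S"
  shows "Cinf_on S (\<lambda>y. sin (a * y $ k))" "Cinf_on S (\<lambda>y. cos (a * y $ k))"
proof -
  \<comment> \<open>Each differentiation of \<open>sin\<close> shifts the argument by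
    \<open>pi/2\<close>; the shifts \<open>m = 0\<close> and \<open>m = 1\<close> are
    \<open>sin\<close> and \<open>cos\<close>.\<close>
  have "((\<lambda>x. sin (x + real m * (pi/2))) has_real_derivative sin (t + real (Suc m) * (pi/2))) (at t)"
    for m t
    by (auto intro!: derivative_eq_intros simp: algebra_simps sin_add cos_add add_divide_distrib)
  note D = Ck_on_coordinate_fun[OF assms, of "\<lambda>m x. sin (x + real m * (pi/2))", OF this]
  show "Cinf_on S (\<lambda>y. sin (a * y $ k))" "Cinf_on S (\<lambda>y. cos (a * y $ k))"
    using D[where m=0] D[where m=1] by (simp_all add: Cinf_on_def sin_add)
qed

lemma Cinf_on_hyp:
  assumes "open S"
  shows "Cinf_on S (\<lambda>y. sinh (a * y $ k))" "Cinf_on S (\<lambda>y. cosh (a * y $ k))"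
proof -
  have "((if even m then sinh else cosh) has_real_derivative
      (if even (Suc m) then sinh else cosh) t) (at t)" for m :: nat and t :: real
    using has_field_derivative_sinh[OF DERIV_ident, of t UNIV]
      has_field_derivative_cosh[OF DERIV_ident, of t UNIV]
    by (cases "even m") simp_all
  note D = Ck_on_coordinate_fun[OF assms, of "\<lambda>m. if even m then sinh else cosh", OF this]
  show "Cinf_on S (\<lambda>y. sinh (a * y $ k))" "Cinf_on S (\<lambda>y. cosh (a * y $ k))"
    using D[where m=0] D[where m=1] by (simp_all add: Cinf_on_def)
qed

section \<open>Smoothness of complex functions of the coordinates\<close>

definition csmooth_on :: "(real^3) set \<Rightarrow> (real^3 \<Rightarrow> complex) \<Rightarrow> bool" where
  "csmooth_on S f \<longleftrightarrow> Cinf_on S (\<lambda>y. Re (f y)) \<and> Cinf_on S (\<lambda>y. Im (f y))"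

lemma csmooth_on_const: "csmooth_on S (\<lambda>_. c)"
  by (simp add: csmooth_on_def Cinf_on_def Ck_on_const)

lemma csmooth_on_add:
  "open S \<Longrightarrow> csmooth_on S f \<Longrightarrow> csmooth_on S g \<Longrightarrow> csmooth_on S (\<lambda>y. f y + g y)"
  by (simp add: csmooth_on_def Cinf_on_def Ck_on_add)

lemma csmooth_on_mult:
  assumes "open S" "csmooth_on S f" "csmooth_on S g"
  shows "csmooth_on S (\<lambda>y. f y * g y)"
proof -
  \<comment> \<open>The minus sign of the real part is written as a factor \<open>-1\<close>, so
    that closure under sums, products and constants suffices.\<close>
  have "Ck_on n S (\<lambda>y. Re (f y) * Re (g y) + (-1) * (Im (f y) * Im (g y)))"
    and "Ck_on n S (\<lambda>y. Re (f y) * Im (g y) + Im (f y) * Re (g y))" for n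
    using assms unfolding csmooth_on_def Cinf_on_def
    by (intro Ck_on_add Ck_on_mult Ck_on_const; blast)+
  then show ?thesis by (simp add: csmooth_on_def Cinf_on_def algebra_simps)
qed

lemma csmooth_on_minus:
  assumes "open S" "csmooth_on S f"
  shows "csmooth_on S (\<lambda>y. - f y)"
  using csmooth_on_mult[OF assms(1) csmooth_on_const[of S "-1"] assms(2)] by simp

lemma csmooth_on_diff:
  "open S \<Longrightarrow> csmooth_on S f \<Longrightarrow> csmooth_on S g \<Longrightarrow> csmooth_on S (\<lambda>y. f y - g y)"
  using csmooth_on_add[OF _ _ csmooth_on_minus, of S f g] by simp

lemma csmooth_on_of_real: "Cinf_on S f \<Longrightarrow> csmooth_on S (\<lambda>y. complex_of_real (f y))"
  by (simp add: csmooth_on_def Cinf_on_def Ck_on_const)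

lemma half_cis_eq_cis: "half_cis t = cis (t / 2)"
  by (simp add: half_cis_def cis_conv_exp mult.commute)

lemma csmooth_on_half_cis:
  assumes "open S"
  shows "csmooth_on S (\<lambda>y. half_cis (y $ k))" "csmooth_on S (\<lambda>y. half_cis (- (y $ k)))"
  using Cinf_on_trig[OF assms, of "1/2" k] Cinf_on_trig[OF assms, of "-1/2" k]
  by (simp_all add: half_cis_eq_cis csmooth_on_def)

lemma csmooth_on_half_angle:
  assumes "open S"
  shows "csmooth_on S (\<lambda>y. complex_of_real (sin (y $ k / 2)))"
    "csmooth_on S (\<lambda>y. complex_of_real (cos (y $ k / 2)))"
    "csmooth_on S (\<lambda>y. complex_of_real (sinh (y $ k / 2)))"
    "csmooth_on S (\<lambda>y. complex_of_real (cosh (y $ k / 2)))"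
  using Cinf_on_trig[OF assms, of "1/2" k] Cinf_on_hyp[OF assms, of "1/2" k]
  by (simp_all add: csmooth_on_of_real)

lemmas csmooth_on_intros = csmooth_on_const csmooth_on_add csmooth_on_mult csmooth_on_minus
  csmooth_on_diff csmooth_on_half_cis csmooth_on_half_angle

section \<open>Tangent vectors\<close>

lemma chart_open_image: "is_chart (U, x) \<Longrightarrow> open (x ` U)"
  by (simp add: is_chart_def)

lemma chart_inv:
  assumes "is_chart (U, x)" "z \<in> x ` U"
  shows "x (inv_into U x z) = z"
  using assms by (simp add: f_inv_into_f)

text \<open>The whole chart domain \<open>U\<close> serves as the neighbourhood, and
  \<open>x\<close> inverts \<open>inv_into U x\<close> on the image, so the coordinate expression of
  the function is \<open>G\<close> itself there.\<close>

lemma smooth_near_chart: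
  assumes "(U, x) \<in> A" "is_chart (U, x)" "p \<in> U" "Cinf_on (x ` U) G"
  shows "smooth_near A p (\<lambda>q. G (x q))"
proof -
  have "Cinf_on (x ` U) (\<lambda>z. G (x (inv_into U x z)))"
    using assms(4) Ck_on_cong[OF chart_open_image[OF assms(2)], of G] chart_inv[OF assms(2)]
    by (auto simp: Cinf_on_def)
  then show ?thesis
    unfolding smooth_near_def using assms(1-3)
    by (intro bexI[of _ "(U, x)"]) (auto simp: is_chart_def intro!: exI[of _ U])
qed

lemma coord_vector_chart:
  assumes "(U, x) \<in> A" "is_chart (U, x)" "p \<in> U" "Cinf_on (x ` U) G"
  shows "coord_vector A (U, x) k p (\<lambda>q. G (x q)) = partial k G (x p)"
proof -
  have "partial k (\<lambda>z. G (x (inv_into U x z))) (x p) = partial k G (x p)"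
    using assms(3) chart_inv[OF assms(2)]
    by (intro partial_cong[OF chart_open_image[OF assms(2)]]) auto
  with smooth_near_chart[OF assms] show ?thesis
    by (simp add: coord_vector_def)
qed

lemma spinor_field_on_chart:
  assumes "(U, x) \<in> A" "is_chart (U, x)" "\<And>i. csmooth_on (x ` U) (\<lambda>y. F y $ i)"
  shows "spinor_field_on A U (\<lambda>q. F (x q))"
  using assms(3) smooth_near_chart[OF assms(1,2)]
  by (fastforce simp: spinor_field_on_def smooth_fun_on_def csmooth_on_def)

text \<open>\<open>dir_deriv\<close> treats real and imaginary parts separately. As
  \<open>Re\<close> and \<open>Im\<close> are linear, both partial derivatives can be read off one
  complex derivative \<open>F'\<close>.\<close>

lemma dir_deriv_coord_vector:
  assumes "(U, x) \<in> A" "is_chart (U, x)" "p \<in> U" "\<And>i. csmooth_on (x ` U) (\<lambda>y. F y $ i)"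
    and "\<And>i. ((\<lambda>y. F y $ i) has_derivative (\<lambda>h. F' h $ i)) (at (x p))"
  shows "dir_deriv (coord_vector A (U, x) k p) (\<lambda>q. F (x q)) = F' (axis k 1)"
proof -
  have "partial k (\<lambda>y. Re (F y $ i)) (x p) = Re (F' (axis k 1) $ i)"
    "partial k (\<lambda>y. Im (F y $ i)) (x p) = Im (F' (axis k 1) $ i)" for i
    by (rule partial_eqI, rule has_derivative_Re has_derivative_Im, rule assms)+
  moreover have "Cinf_on (x ` U) (\<lambda>y. Re (F y $ i))" "Cinf_on (x ` U) (\<lambda>y. Im (F y $ i))" for i
    using assms(4) by (simp_all add: csmooth_on_def)
  ultimately have "coord_vector A (U, x) k p (\<lambda>q. Re (F (x q) $ i)) = Re (F' (axis k 1) $ i)"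
    "coord_vector A (U, x) k p (\<lambda>q. Im (F (x q) $ i)) = Im (F' (axis k 1) $ i)" for i
    using coord_vector_chart[OF assms(1-3), of "\<lambda>y. Re (F y $ i)" k]
      coord_vector_chart[OF assms(1-3), of "\<lambda>y. Im (F y $ i)" k] by simp_all
  then show ?thesis by (simp add: dir_deriv_def vec_eq_iff)
qed

text \<open>\<open>dir_deriv\<close> only evaluates functionals at fixed functions, so it is linear
  in them. The three shapes are those by which the frame is expressed through coordinate
  vectors.\<close>

lemma dir_deriv_combination:
  "dir_deriv (\<lambda>f. a * v f) \<psi> = of_real a *s dir_deriv v \<psi>"
  "dir_deriv (\<lambda>f. v f + w f) \<psi> = dir_deriv v \<psi> + dir_deriv w \<psi>"
  "dir_deriv (\<lambda>f. v f - w f) \<psi> = dir_deriv v \<psi> - dir_deriv w \<psi>"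
  by (simp_all add: dir_deriv_def vec_eq_iff complex_eq_iff)

lemma dir_deriv_frame_sum:
  fixes v :: "3 \<Rightarrow> 'a tvec"
  shows "dir_deriv (\<lambda>f. \<Sum>j\<in>UNIV. a j * v j f) \<psi> = (\<Sum>j\<in>UNIV. of_real (a j) *s dir_deriv (v j) \<psi>)"
  by (simp add: sum_3 dir_deriv_combination)

lemma tangent_space_combination:
  assumes "v \<in> tangent_space A p" "w \<in> tangent_space A p"
  shows "(\<lambda>f. a * v f + w f) \<in> tangent_space A p"
  using assms unfolding tangent_space_def by (simp add: algebra_simps)

lemma tangent_space_zero: "(\<lambda>f. 0) \<in> tangent_space A p"
  by (simp add: tangent_space_def)

lemma smooth_near_const:
  assumes "smooth_structure A"
  shows "smooth_near A p (\<lambda>_. a)"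
proof -
  have "p \<in> (\<Union>c\<in>A. fst c)" and ch: "\<forall>c\<in>A. is_chart c"
    using assms unfolding smooth_structure_def by blast+
  then obtain U x where "(U, x) \<in> A" "p \<in> U" by auto
  moreover from this ch have "is_chart (U, x)" by blast
  ultimately show ?thesis
    using smooth_near_chart[of U x A p "\<lambda>_. a"] by (simp add: Cinf_on_def Ck_on_const)
qed

lemma tangent_space_const:
  assumes "smooth_structure A" "v \<in> tangent_space A p"
  shows "v (\<lambda>_. a) = 0"
proof -
  have *: "v (\<lambda>q. a * b + c) = a * v (\<lambda>_. b) + v (\<lambda>_. c)" "v (\<lambda>q. b * c) = b * v (\<lambda>_. c) + c * v (\<lambda>_. b)"
    for a b c
    using assms(2) smooth_near_const[OF assms(1)] unfolding tangent_space_def by auto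
  \<comment> \<open>The Leibniz rule for \<open>1 * 1\<close> gives
    \<open>v 1 = 2 * v 1\<close>.\<close>
  have "v (\<lambda>_. 1) = 0" using *(2)[of 1 1] by simp
  \<comment> \<open>The second instance reads \<open>v 0 = - v 0 + v 0\<close>, so
    \<open>v 0 = 0\<close>; the first then becomes \<open>v a = a * v 1\<close>.\<close>
  then show ?thesis using *(1)[of a 1 0] *(1)[of "-1" 0 0] by simp
qed

section \<open>SqK-spinors in terms of the frame\<close>

context
  fixes r :: nat and A :: "'a::topological_space atlas" and \<xi> :: "'a vfield" and \<eta> :: "'a form1"
    and g :: "'a form2" and H :: real and e :: "3 \<Rightarrow> 'a vfield"
  assumes frame: "sasakian_frame r A \<xi> g H e"
begin

lemma frame_tangent: "e j p \<in> tangent_space A p"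
  using frame by (simp add: sasakian_frame_def vector_field_def)

lemma coframe_eqI:
  assumes "v \<in> tangent_space A p" "v = (\<lambda>f. \<Sum>j\<in>UNIV. c $ j * e j p f)"
  shows "coframe e j p v = c $ j"
proof -
  have "\<exists>!c :: real^3. v = (\<lambda>f. \<Sum>j\<in>UNIV. c $ j * e j p f)"
    using frame assms(1) by (simp add: sasakian_frame_def)
  with assms(2) have "(THE c :: real^3. v = (\<lambda>f. \<Sum>j\<in>UNIV. c $ j * e j p f)) = c"
    by (intro the1_equality) auto
  then show ?thesis by (simp add: coframe_def)
qed

lemma coframe_expansion:
  assumes "v \<in> tangent_space A p"
  shows "v = (\<lambda>f. \<Sum>j\<in>UNIV. coframe e j p v * e j p f)"
proof -
  obtain c :: "real^3" where c: "v = (\<lambda>f. \<Sum>j\<in>UNIV. c $ j * e j p f)"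
    using frame assms unfolding sasakian_frame_def by blast
  show ?thesis using coframe_eqI[OF assms c] c by simp
qed

lemma coframe_xi: "coframe e j p (\<xi> p) = (if j = 1 then 1 else 0)"
proof -
  have "e 1 = \<xi>" using frame by (simp add: sasakian_frame_def)
  then show ?thesis
    using coframe_eqI[OF frame_tangent, of 1 p "axis 1 1" j]
    by (simp add: axis_def if_distrib[of "\<lambda>t. t * _"] cong: if_cong)
qed

lemma clifford_xi: "clifford r e p (\<xi> p) s = gam r 1 *v s"
  by (simp add: clifford_def coframe_xi if_distrib[of of_real] if_distrib[of "\<lambda>t. t *s _"] cong: if_cong)

text \<open>A one-form is determined by its values on the frame, here those of the first member of
  the dual coframe. This turns the \<open>\<eta>\<close> term of the SqK equation into a coframe
  coefficient.\<close>

lemma one_form_frame: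
  assumes "one_form A \<eta>" "\<And>j. \<eta> p (e j p) = (if j = 1 then 1 else 0)" "v \<in> tangent_space A p"
  shows "\<eta> p v = coframe e 1 p v"
proof -
  have lin: "\<eta> p (\<lambda>f. c * v f + w f) = c * \<eta> p v + \<eta> p w"
    if "v \<in> tangent_space A p" "w \<in> tangent_space A p" for c v w
    using assms(1) that unfolding one_form_def by blast
  have z: "\<eta> p (\<lambda>f. 0) = 0"
    using lin[OF tangent_space_zero tangent_space_zero, of 1] by simp
  let ?c = "\<lambda>j. coframe e j p v"
  \<comment> \<open>The trailing \<open>0\<close> gives every partial sum the shape
    \<open>c * v f + w f\<close> of the linearity rule, down to the zero vector.\<close>
  have "\<eta> p v = \<eta> p (\<lambda>f. ?c 1 * e 1 p f + (?c 2 * e 2 p f + (?c 3 * e 3 p f + 0)))"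
    using coframe_expansion[OF assms(3)] by (simp add: sum_3 add.assoc)
  also have "\<dots> = ?c 1 * \<eta> p (e 1 p) + (?c 2 * \<eta> p (e 2 p) + (?c 3 * \<eta> p (e 3 p) + 0))"
    by (simp only: lin frame_tangent tangent_space_combination tangent_space_zero z)
  finally show ?thesis by (simp add: assms(2))
qed

text \<open>The spin form multiplies every \<open>gam r j\<close> by \<open>(- \<i>) ^ r / 2\<close>
  and \<open>gam r 1\<close> by a further term containing \<open>H\<close>. Moving these to the
  right-hand side leaves \<open>k\<close> for \<open>j = 2, 3\<close>; for \<open>j = 1\<close> the
  \<open>\<eta>\<close> term contributes \<open>b\<close> as well, hence \<open>l\<close>.\<close>

lemma sqk_spinor_on_frameI:
  assumes eta: "one_form A \<eta>" "\<And>p j. \<eta> p (e j p) = (if j = 1 then 1 else 0)"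
    and sm: "spinor_field_on A S \<psi>"
    and l: "l = complex_of_real (a + b) * \<i> ^ r - (- \<i>) ^ r / 2
               - \<i> ^ r * ((complex_of_real H + (- 1) powi (int r - 1)) / 4)"
    and k: "k = complex_of_real a * \<i> ^ r - (- \<i>) ^ r / 2"
    and d: "\<And>p. p \<in> S \<Longrightarrow> dir_deriv (e 1 p) \<psi> = l *s (gam r 1 *v \<psi> p)"
      "\<And>p. p \<in> S \<Longrightarrow> dir_deriv (e 2 p) \<psi> = k *s (gam r 2 *v \<psi> p)"
      "\<And>p. p \<in> S \<Longrightarrow> dir_deriv (e 3 p) \<psi> = k *s (gam r 3 *v \<psi> p)"
  shows "sqk_spinor_on r A \<xi> \<eta> H e S a b \<psi>"
  unfolding sqk_spinor_on_def
proof (intro conjI sm ballI)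
  fix p v assume p: "p \<in> S" and v: "v \<in> tangent_space A p"
  let ?c = "\<lambda>j. complex_of_real (coframe e j p v)"
  have D: "dir_deriv v \<psi> = (\<Sum>j\<in>UNIV. ?c j *s dir_deriv (e j p) \<psi>)"
    by (subst coframe_expansion[OF v]) (rule dir_deriv_frame_sum)
  \<comment> \<open>Turns the scalar matrices of \<open>spin_form\<close> into scalar
    multiplication, so that both sides combine the same vectors
    \<open>gam r j *v \<psi> p\<close>.\<close>
  have m: "(mat c :: complex^2^2) *v s = c *s s" for c :: complex and s
    by (simp add: vec_eq_iff matrix_vector_mult_def mat_def forall_2 sum_2)
  show "spin_connection r e H p v \<psi> =
          (complex_of_real a * \<i> ^ r) *s clifford r e p v (\<psi> p) +
          (complex_of_real b * \<i> ^ r * complex_of_real (\<eta> p v)) *s clifford r e p (\<xi> p) (\<psi> p)"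
    unfolding spin_connection_def D one_form_frame[OF eta v] clifford_def spin_form_def
    by (simp add: vec_eq_iff sum_3 d[OF p] l k coframe_xi
        matrix_vector_mul_assoc[symmetric] m algebra_simps)
qed

end

section \<open>The contact form on a Sasakian frame\<close>

text \<open>Here \<open>g'\<close> is the Riemannian metric of the contact structure;
  \<open>c\<close> is 0 for even and 2 for odd \<open>r\<close>. Compatibility with
  \<open>\<phi>\<close> forces \<open>\<phi>\<close> to kill \<open>\<xi>\<close>, hence pairing
  with \<open>\<xi>\<close> under \<open>g'\<close> is \<open>\<eta>\<close>, and orthogonality of
  the frame for \<open>g\<close> carries over to \<open>\<eta>\<close>.\<close>

lemma one_form_frame_sasakian:
  assumes contact: "contact_metric A \<phi> \<xi> \<eta> g'" and g': "g' = (\<lambda>p v w. g p v w + c * \<eta> p v * \<eta> p w)"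
    and frame: "sasakian_frame r A \<xi> g H e" and c: "c = 1 - (-1) ^ r"
  shows "\<eta> p (e j p) = (if j = 1 then 1 else 0)"
proof -
  have xi: "e 1 = \<xi>" and on: "\<And>i j. g p (e i p) (e j p) = (if i \<noteq> j then 0 else if i = 1 then (-1) ^ r else 1)"
    using frame by (auto simp: sasakian_frame_def)
  have T: "e j p \<in> tangent_space A p" for j
    using frame_tangent[OF frame] .
  have eta1: "\<eta> p (e 1 p) = 1" using contact xi by (simp add: contact_metric_def)
  have rm: "riemannian_metric A g'" and en: "endomorphism_field A \<phi>"
    and gphi: "\<And>v w. v \<in> tangent_space A p \<Longrightarrow> w \<in> tangent_space A p \<Longrightarrow>
        g' p (\<phi> p v) (\<phi> p w) = g' p v w - \<eta> p v * \<eta> p w"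
    using contact by (simp_all add: contact_metric_def)
  have phi: "\<phi> p v \<in> tangent_space A p" if "v \<in> tangent_space A p" for v
    using en that by (simp add: endomorphism_field_def)
  have pos: "g' p v v > 0" if "v \<in> tangent_space A p" "v \<noteq> (\<lambda>f. 0)" for v
    using rm that by (simp add: riemannian_metric_def)
  have lin: "g' p (\<lambda>f. c * u f + v f) w = c * g' p u w + g' p v w"
    if "u \<in> tangent_space A p" "v \<in> tangent_space A p" "w \<in> tangent_space A p" for c u v w
    using rm that by (simp add: riemannian_metric_def)
  \<comment> \<open>By the choice of \<open>c\<close>,
    \<open>g' p (e 1 p) (e 1 p) = (-1) ^ r + c = 1\<close>, which the square of
    \<open>\<eta> p (e 1 p)\<close> cancels.\<close>
  have "g' p (\<phi> p (e 1 p)) (\<phi> p (e 1 p)) = 0"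
    using gphi[OF T T, of 1 1] eta1 by (simp add: g' on c)
  then have z: "\<phi> p (e 1 p) = (\<lambda>f. 0)"
    using pos[OF phi[OF T], of 1] by force
  have "g' p (\<lambda>f. 0) w = 0" if "w \<in> tangent_space A p" for w
    using lin[OF tangent_space_zero tangent_space_zero that, of 1] by simp
  then have "g' p (e 1 p) (e j p) = \<eta> p (e j p)"
    using gphi[OF T T, of 1 j] eta1 z phi[OF T, of j] by simp
  \<comment> \<open>By its definition \<open>g'\<close> takes the value
    \<open>c * \<eta> p (e j p)\<close> on \<open>e 1 p\<close> and \<open>e j p\<close>; the
    remaining factor \<open>c - 1 = - ((-1) ^ r)\<close> is nonzero.\<close>
  then have "j \<noteq> 1 \<Longrightarrow> (c - 1) * \<eta> p (e j p) = 0"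
    by (simp add: g' on eta1 algebra_simps)
  with eta1 c show ?thesis by (cases "even r") auto
qed

lemma one_form_frame_riemannian:
  assumes "sasakian A \<phi> \<xi> \<eta> g" "sasakian_frame 0 A \<xi> g H e"
  shows "\<eta> p (e j p) = (if j = 1 then 1 else 0)"
proof -
  have "contact_metric A \<phi> \<xi> \<eta> g" using assms(1) by (simp add: sasakian_def)
  then show ?thesis
    by (rule one_form_frame_sasakian[OF _ _ assms(2), where c=0]) simp_all
qed

lemma one_form_frame_lorentzian:
  assumes "lorentzian_sasakian A \<phi> \<xi> \<eta> g" "sasakian_frame 1 A \<xi> g H e"
  shows "\<eta> p (e j p) = (if j = 1 then 1 else 0)"
proof -
  have "contact_metric A \<phi> \<xi> \<eta> (\<lambda>p v w. g p v w + 2 * \<eta> p v * \<eta> p w)"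
    using assms(1) by (simp add: sasakian_def lorentzian_sasakian_def)
  then show ?thesis
    by (rule one_form_frame_sasakian[OF _ refl assms(2)]) simp
qed

text \<open>Constants have zero derivative along every tangent vector, and the assumptions on
  \<open>a\<close> and \<open>b\<close> express that \<open>k\<close> and \<open>l\<close>
  vanish.\<close>

lemma sqk_spinor_const:
  assumes frame: "sasakian_frame r A \<xi> g H e" and sm: "smooth_structure A"
    and eta: "one_form A \<eta>" "\<And>p j. \<eta> p (e j p) = (if j = 1 then 1 else 0)"
    and a: "complex_of_real a * \<i> ^ r = (- \<i>) ^ r / 2"
    and b: "complex_of_real b = (complex_of_real H + (- 1) powi (int r - 1)) / 4"
  shows "sqk_spinor_on r A \<xi> \<eta> H e UNIV a b (\<lambda>_. s)"
proof (rule sqk_spinor_on_frameI[OF frame, where k=0 and l=0])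
  show "spinor_field_on A UNIV (\<lambda>_. s)"
    using smooth_near_const[OF sm] by (simp add: spinor_field_on_def smooth_fun_on_def)
  have "dir_deriv (e j p) (\<lambda>_. s) = 0" for j p
    by (simp add: dir_deriv_def vec_eq_iff tangent_space_const[OF sm frame_tangent[OF frame]]
        Complex_eq_0)
  then show "dir_deriv (e 1 p) (\<lambda>_. s) = 0 *s (gam r 1 *v s)"
    "dir_deriv (e 2 p) (\<lambda>_. s) = 0 *s (gam r 2 *v s)"
    "dir_deriv (e 3 p) (\<lambda>_. s) = 0 *s (gam r 3 *v s)" for p
    by simp_all
  show "0 = complex_of_real (a + b) * \<i> ^ r - (- \<i>) ^ r / 2
      - \<i> ^ r * ((complex_of_real H + (- 1) powi (int r - 1)) / 4)"
    unfolding of_real_add distrib_right a b by simp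
  show "0 = complex_of_real a * \<i> ^ r - (- \<i>) ^ r / 2"
    unfolding a by simp
qed (fact eta)+

section \<open>The explicit spinors\<close>

text \<open>The simplifier normalises the natural number \<open>1\<close> to \<open>Suc 0\<close>,
  hence this form of the Lorentzian rules.\<close>

lemma gam_mult:
  "gam 0 1 *v s = vector [\<i> * s $ 2, \<i> * s $ 1]"
  "gam 0 2 *v s = vector [s $ 2, - s $ 1]"
  "gam 0 3 *v s = vector [\<i> * s $ 1, - \<i> * s $ 2]"
  "gam (Suc 0) 1 *v s = vector [s $ 2, s $ 1]"
  "gam (Suc 0) 2 *v s = vector [s $ 2, - s $ 1]"
  "gam (Suc 0) 3 *v s = vector [\<i> * s $ 1, - \<i> * s $ 2]"
  by (simp_all add: gam_def pauli_def vec_eq_iff matrix_vector_mult_def matrix_matrix_mult_def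
      mat_def sum_2 forall_2 power_int_minus)

lemma gam_1_anticomm:
  assumes "r \<le> 1" "j \<noteq> 1"
  shows "gam r 1 *v (gam r j *v s) = - (gam r j *v (gam r 1 *v s))"
proof -
  have "r = 0 \<or> r = Suc 0" using assms(1) by auto
  moreover have "j = 2 \<or> j = 3" using assms(2) exhaust_3[of j] by blast
  ultimately show ?thesis
    by (elim disjE) (simp_all only: gam_mult, simp_all add: vec_eq_iff forall_2)
qed

section \<open>Closed forms and coordinate derivatives of the explicit spinors\<close>

text \<open>The matrix product is evaluated from the right: \<open>P\<close>, \<open>Q\<close> come
  from the diagonal phases in \<open>\<varphi>\<close>, \<open>q\<close>, \<open>q'\<close> from the
  matrix in \<open>\<theta>\<close>, and the outer factor mixes these. The letters keep this role in
  what follows.\<close>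

lemma berger_spinor_eq:
  "berger_spinor y C =
     (let P = half_cis (y $ 2) * C $ 1; Q = half_cis (- (y $ 2)) * C $ 2;
          s = complex_of_real (sin (y $ 1 / 2)); c = complex_of_real (cos (y $ 1 / 2));
          q = c * P - \<i> * s * Q; q' = c * Q - \<i> * s * P
      in vector [half_cis (y $ 3) * q + half_cis (- (y $ 3)) * q',
                 half_cis (- (y $ 3)) * q' - half_cis (y $ 3) * q])"
  by (simp add: berger_spinor_def matrix_vector_mult_def sum_2 vec_eq_iff forall_2 Let_def algebra_simps)

lemma lorentz_spinor_eq:
  "lorentz_spinor y C =
     (let P = half_cis (y $ 2) * C $ 1; Q = half_cis (- (y $ 2)) * C $ 2;
          s = complex_of_real (sinh (y $ 1 / 2)); c = complex_of_real (cosh (y $ 1 / 2));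
          q = c * P - \<i> * s * Q; q' = c * Q + \<i> * s * P
      in vector [half_cis (y $ 3) * q + half_cis (- (y $ 3)) * q',
                 half_cis (y $ 3) * q - half_cis (- (y $ 3)) * q'])"
  by (simp add: lorentz_spinor_def matrix_vector_mult_def sum_2 vec_eq_iff forall_2 Let_def algebra_simps)

text \<open>The product rule in closed form: \<open>u * d\<close> and \<open>v * d'\<close> are the
  differentials of \<open>u * q\<close> and \<open>v * q'\<close>. The
  \<open>\<theta>\<close>-derivative exchanges \<open>q\<close> and \<open>q'\<close> up to the
  factor \<open>- \<i> / 2\<close>; the \<open>\<varphi>\<close>-derivative gives \<open>P\<close>
  and \<open>Q\<close> opposite signs.\<close>

definition berger_spinor_deriv :: "real^3 \<Rightarrow> complex^2 \<Rightarrow> real^3 \<Rightarrow> complex^2" where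
  "berger_spinor_deriv y C h =
     (let P = half_cis (y $ 2) * C $ 1; Q = half_cis (- (y $ 2)) * C $ 2;
          s = complex_of_real (sin (y $ 1 / 2)); c = complex_of_real (cos (y $ 1 / 2));
          q = c * P - \<i> * s * Q; q' = c * Q - \<i> * s * P;
          u = half_cis (y $ 3); v = half_cis (- (y $ 3));
          d = \<i> / 2 * (h $ 3 * q - h $ 1 * q' + h $ 2 * (c * P + \<i> * s * Q));
          d' = \<i> / 2 * (- h $ 3 * q' - h $ 1 * q - h $ 2 * (c * Q + \<i> * s * P))
      in vector [u * d + v * d', v * d' - u * d])"

text \<open>Here the \<open>\<chi>\<close>-derivative sends \<open>q\<close> to
  \<open>- \<i> / 2 * q'\<close> but \<open>q'\<close> to \<open>\<i> / 2 * q\<close>.\<close>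

definition lorentz_spinor_deriv :: "real^3 \<Rightarrow> complex^2 \<Rightarrow> real^3 \<Rightarrow> complex^2" where
  "lorentz_spinor_deriv y C h =
     (let P = half_cis (y $ 2) * C $ 1; Q = half_cis (- (y $ 2)) * C $ 2;
          s = complex_of_real (sinh (y $ 1 / 2)); c = complex_of_real (cosh (y $ 1 / 2));
          q = c * P - \<i> * s * Q; q' = c * Q + \<i> * s * P;
          u = half_cis (y $ 3); v = half_cis (- (y $ 3));
          d = \<i> / 2 * (h $ 3 * q - h $ 1 * q' + h $ 2 * (c * P + \<i> * s * Q));
          d' = \<i> / 2 * (- h $ 3 * q' + h $ 1 * q + h $ 2 * (\<i> * s * P - c * Q))
      in vector [u * d + v * d', u * d - v * d'])"

lemma half_cis_has_derivative:
  fixes y :: "real^3"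
  shows "((\<lambda>y. half_cis (y $ k)) has_derivative (\<lambda>h. half_cis (y $ k) * (\<i> / 2 * h $ k))) (at y)"
    "((\<lambda>y. half_cis (- (y $ k))) has_derivative (\<lambda>h. half_cis (- (y $ k)) * (- \<i> / 2 * h $ k))) (at y)"
proof -
  have lin: "((\<lambda>y::real^3. a * complex_of_real (y $ k)) has_derivative (\<lambda>h. a * complex_of_real (h $ k))) (at y)" for a :: complex
    by (intro has_derivative_mult_right has_derivative_of_real bounded_linear_imp_has_derivative
        bounded_linear_vec_nth)
  have "((\<lambda>y. exp (a * complex_of_real (y $ k))) has_derivative
      (\<lambda>h. exp (a * complex_of_real (y $ k)) * (a * h $ k))) (at y)" for a :: complex
    by (rule has_derivative_compose[OF lin DERIV_exp[unfolded has_field_derivative_def]])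
  from this[of "\<i> / 2"] this[of "- \<i> / 2"]
  show "((\<lambda>y. half_cis (y $ k)) has_derivative (\<lambda>h. half_cis (y $ k) * (\<i> / 2 * h $ k))) (at y)"
    "((\<lambda>y. half_cis (- (y $ k))) has_derivative (\<lambda>h. half_cis (- (y $ k)) * (- \<i> / 2 * h $ k))) (at y)"
    by (simp_all add: half_cis_def)
qed

lemma half_angle_has_derivative:
  fixes y :: "real^3"
  shows "((\<lambda>y. complex_of_real (sin (y $ k / 2))) has_derivative
      (\<lambda>h. complex_of_real (cos (y $ k / 2)) * (h $ k / 2))) (at y)"
    "((\<lambda>y. complex_of_real (cos (y $ k / 2))) has_derivative
      (\<lambda>h. - complex_of_real (sin (y $ k / 2)) * (h $ k / 2))) (at y)"
    "((\<lambda>y. complex_of_real (sinh (y $ k / 2))) has_derivative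
      (\<lambda>h. complex_of_real (cosh (y $ k / 2)) * (h $ k / 2))) (at y)"
    "((\<lambda>y. complex_of_real (cosh (y $ k / 2))) has_derivative
      (\<lambda>h. complex_of_real (sinh (y $ k / 2)) * (h $ k / 2))) (at y)"
proof -
  have lin: "((\<lambda>y::real^3. y $ k / 2) has_derivative (\<lambda>h. h $ k / 2)) (at y)"
    using has_derivative_mult_right[OF bounded_linear_imp_has_derivative[OF bounded_linear_vec_nth], of "1/2::real" k "at y"]
    by simp
  have D: "((\<lambda>y. complex_of_real (f (y $ k / 2))) has_derivative
      (\<lambda>h. complex_of_real (d * (h $ k / 2)))) (at y)"
    if "(f has_real_derivative d) (at (y $ k / 2))" for f d
    by (rule has_derivative_of_real[OF has_derivative_compose[OF lin that[unfolded has_field_derivative_def]]])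
  show "((\<lambda>y. complex_of_real (sin (y $ k / 2))) has_derivative
      (\<lambda>h. complex_of_real (cos (y $ k / 2)) * (h $ k / 2))) (at y)"
    using D[OF DERIV_sin] by simp
  show "((\<lambda>y. complex_of_real (cos (y $ k / 2))) has_derivative
      (\<lambda>h. - complex_of_real (sin (y $ k / 2)) * (h $ k / 2))) (at y)"
    using D[OF DERIV_cos] by simp
  show "((\<lambda>y. complex_of_real (sinh (y $ k / 2))) has_derivative
      (\<lambda>h. complex_of_real (cosh (y $ k / 2)) * (h $ k / 2))) (at y)"
    using D[OF has_field_derivative_sinh[OF DERIV_ident]] by simp
  show "((\<lambda>y. complex_of_real (cosh (y $ k / 2))) has_derivative
      (\<lambda>h. complex_of_real (sinh (y $ k / 2)) * (h $ k / 2))) (at y)"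
    using D[OF has_field_derivative_cosh[OF DERIV_ident]] by simp
qed

lemma berger_spinor_has_derivative:
  "((\<lambda>y. berger_spinor y C $ i) has_derivative (\<lambda>h. berger_spinor_deriv y C h $ i)) (at y)"
proof -
  have "\<forall>i. ((\<lambda>y. berger_spinor y C $ i) has_derivative (\<lambda>h. berger_spinor_deriv y C h $ i)) (at y)"
    unfolding forall_2 berger_spinor_eq berger_spinor_deriv_def Let_def vector_2
    \<comment> \<open>The derivative stays schematic while the product rule assembles it; only then
      is it compared with the closed form by algebra.\<close>
    by (intro conjI; (rule has_derivative_eq_rhs,
          ((rule has_derivative_add has_derivative_diff half_cis_has_derivative half_angle_has_derivative
             has_derivative_mult has_derivative_const)+)[1],
          rule ext, simp add: algebra_simps add_divide_distrib diff_divide_distrib))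
  then show ?thesis by blast
qed

lemma lorentz_spinor_has_derivative:
  "((\<lambda>y. lorentz_spinor y C $ i) has_derivative (\<lambda>h. lorentz_spinor_deriv y C h $ i)) (at y)"
proof -
  have "\<forall>i. ((\<lambda>y. lorentz_spinor y C $ i) has_derivative (\<lambda>h. lorentz_spinor_deriv y C h $ i)) (at y)"
    unfolding forall_2 lorentz_spinor_eq lorentz_spinor_deriv_def Let_def vector_2
    by (intro conjI; (rule has_derivative_eq_rhs,
          ((rule has_derivative_add has_derivative_diff half_cis_has_derivative half_angle_has_derivative
             has_derivative_mult has_derivative_const)+)[1],
          rule ext, simp add: algebra_simps add_divide_distrib diff_divide_distrib))
  then show ?thesis by blast
qed

lemma csmooth_on_berger_spinor:
  assumes "open S"
  shows "csmooth_on S (\<lambda>y. berger_spinor y C $ i)"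
proof -
  have "\<forall>i. csmooth_on S (\<lambda>y. berger_spinor y C $ i)"
    unfolding forall_2 berger_spinor_eq Let_def vector_2 using assms
    by (intro conjI csmooth_on_intros)
  then show ?thesis by blast
qed

lemma csmooth_on_lorentz_spinor:
  assumes "open S"
  shows "csmooth_on S (\<lambda>y. lorentz_spinor y C $ i)"
proof -
  have "\<forall>i. csmooth_on S (\<lambda>y. lorentz_spinor y C $ i)"
    unfolding forall_2 lorentz_spinor_eq Let_def vector_2 using assms
    by (intro conjI csmooth_on_intros)
  then show ?thesis by blast
qed

section \<open>Half-angle identities and derivatives along the frame\<close>

lemma half_cis_inverse: "half_cis t * half_cis (- t) = 1"
  by (simp add: half_cis_eq_cis cis_mult)

text \<open>Multiplication by \<open>cis (- t)\<close> and \<open>cis t\<close> takes the half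
  angles \<open>t / 2\<close> and \<open>- t / 2\<close> into each other. With right-hand side 0,
  the defects of the frame equations can be collected and rewritten to zero.\<close>

lemma half_cis_rotate:
  "complex_of_real (cos t) * half_cis t - \<i> * complex_of_real (sin t) * half_cis t - half_cis (- t) = 0"
  "complex_of_real (cos t) * half_cis (- t) + \<i> * complex_of_real (sin t) * half_cis (- t) - half_cis t = 0"
proof -
  have "cis t = complex_of_real (cos t) + \<i> * complex_of_real (sin t)"
    "cis (- t) = complex_of_real (cos t) - \<i> * complex_of_real (sin t)"
    by (simp_all add: complex_eq_iff)
  moreover have "- t + t / 2 = - t / 2" "t + - t / 2 = t / 2" by simp_all
  then have "cis (- t) * half_cis t = half_cis (- t)" "cis t * half_cis (- t) = half_cis t"
    unfolding half_cis_eq_cis cis_mult by metis+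
  ultimately show
    "complex_of_real (cos t) * half_cis t - \<i> * complex_of_real (sin t) * half_cis t - half_cis (- t) = 0"
    "complex_of_real (cos t) * half_cis (- t) + \<i> * complex_of_real (sin t) * half_cis (- t) - half_cis t = 0"
    by (simp_all add: ring_distribs)
qed

lemma sin_cos_half_angle:
  "complex_of_real (sin t) = 2 * complex_of_real (sin (t / 2)) * complex_of_real (cos (t / 2))"
  "complex_of_real (cos t) = complex_of_real (cos (t / 2)) * complex_of_real (cos (t / 2)) -
     complex_of_real (sin (t / 2)) * complex_of_real (sin (t / 2))"
  "complex_of_real (cos (t / 2)) * complex_of_real (cos (t / 2)) +
     complex_of_real (sin (t / 2)) * complex_of_real (sin (t / 2)) = 1"
  using arg_cong[OF sin_double[of "t / 2"], of complex_of_real]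
    arg_cong[OF cos_double[of "t / 2"], of complex_of_real]
    arg_cong[OF sin_cos_squared_add3[of "t / 2"], of complex_of_real]
  by (simp_all add: power2_eq_square del: sin_cos_squared_add3)

lemma sinh_cosh_half_angle:
  "complex_of_real (sinh t) = 2 * complex_of_real (sinh (t / 2)) * complex_of_real (cosh (t / 2))"
  "complex_of_real (cosh t) = complex_of_real (cosh (t / 2)) * complex_of_real (cosh (t / 2)) +
     complex_of_real (sinh (t / 2)) * complex_of_real (sinh (t / 2))"
  "complex_of_real (cosh (t / 2)) * complex_of_real (cosh (t / 2)) -
     complex_of_real (sinh (t / 2)) * complex_of_real (sinh (t / 2)) = 1"
  using arg_cong[OF sinh_double[of "t / 2"], of complex_of_real]
    arg_cong[OF cosh_double[of "t / 2"], of complex_of_real]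
    arg_cong[OF cosh_square_eq[of "t / 2"], of complex_of_real]
  by (simp_all add: power2_eq_square)

text \<open>In the frame vectors the second and third coordinate derivatives have coefficients
  \<open>t / m\<close> and \<open>k / m * t\<close>, where \<open>m\<close> is \<open>sin\<close> or
  \<open>sinh\<close> and \<open>k\<close> is \<open>cos\<close> or \<open>cosh\<close> of the first
  coordinate. The assumption exhibits the divisor \<open>m\<close>, so a regular term
  remains.\<close>

lemma scale_combination:
  fixes a b G :: "complex^2"
  assumes "a - of_real k *s b = of_real m *s G" "m \<noteq> 0"
  shows "of_real (t / m) *s a - of_real (k / m * t) *s b = of_real t *s G"
proof -
  have "of_real (t / m) *s a - of_real (k / m * t) *s b = of_real (t / m) *s (a - of_real k *s b)"
    by (simp add: vec_eq_iff algebra_simps)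
  also have "\<dots> = of_real t *s G"
    unfolding assms(1) using assms(2) by (simp add: vector_smult_assoc)
  finally show ?thesis .
qed

text \<open>The left-hand sides are the frame directions without their prefactors
  \<open>2 / \<alpha>\<close> and \<open>2 / sqrt \<alpha>\<close>, so \<open>\<alpha>\<close> drops
  out and all three coefficients are \<open>-1/2\<close>.\<close>

lemma berger_spinor_frame_deriv:
  assumes "sin (y $ 1) \<noteq> 0"
  shows "berger_spinor_deriv y C (axis 3 1) = (-1/2) *s (gam 0 1 *v berger_spinor y C)"
    and "of_real (- sin (y $ 3)) *s berger_spinor_deriv y C (axis 1 1)
       + of_real (cos (y $ 3) / sin (y $ 1)) *s berger_spinor_deriv y C (axis 2 1)
       - of_real (cot (y $ 1) * cos (y $ 3)) *s berger_spinor_deriv y C (axis 3 1)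
       = (-1/2) *s (gam 0 2 *v berger_spinor y C)" (is ?e2)
    and "of_real (cos (y $ 3)) *s berger_spinor_deriv y C (axis 1 1)
       + of_real (sin (y $ 3) / sin (y $ 1)) *s berger_spinor_deriv y C (axis 2 1)
       - of_real (cot (y $ 1) * sin (y $ 3)) *s berger_spinor_deriv y C (axis 3 1)
       = (-1/2) *s (gam 0 3 *v berger_spinor y C)" (is ?e3)
proof -
  let ?d = "\<lambda>k. berger_spinor_deriv y C (axis k 1)"
  define P Q where PQ: "P = half_cis (y $ 2) * C $ 1" "Q = half_cis (- (y $ 2)) * C $ 2"
  define s c where sc: "s = complex_of_real (sin (y $ 1 / 2))" "c = complex_of_real (cos (y $ 1 / 2))"
  define u v where uv: "u = half_cis (y $ 3)" "v = half_cis (- (y $ 3))"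
  define q q' where q: "q = c * P - \<i> * s * Q" "q' = c * Q - \<i> * s * P"
  \<comment> \<open>\<open>G\<close> is the quotient of \<open>?d 2 - cos \<theta> *s ?d 3\<close>
    by \<open>sin \<theta>\<close>, the combination through which these two derivatives enter
    \<open>e 2\<close> and \<open>e 3\<close>.\<close>
  define G :: "complex^2" where "G = vector [(v * q - u * q') / 2, (v * q + u * q') / 2]"
  have F: "berger_spinor y C = vector [u * q + v * q', v * q' - u * q]"
    by (simp add: berger_spinor_eq PQ sc uv q Let_def)
  have d: "?d 1 = vector [- \<i> / 2 * (u * q' + v * q), - \<i> / 2 * (v * q - u * q')]"
    "?d 2 = vector [\<i> / 2 * (u * (c * P + \<i> * s * Q) - v * (c * Q + \<i> * s * P)),
                    \<i> / 2 * (- v * (c * Q + \<i> * s * P) - u * (c * P + \<i> * s * Q))]"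
    "?d 3 = vector [\<i> / 2 * (u * q - v * q'), \<i> / 2 * (- v * q' - u * q)]"
    by (simp_all add: berger_spinor_deriv_def PQ sc uv q axis_def Let_def vec_eq_iff forall_2 algebra_simps
        add_divide_distrib diff_divide_distrib)
  show "?d 3 = (-1/2) *s (gam 0 1 *v berger_spinor y C)"
    unfolding d F
    by (simp add: gam_mult vec_eq_iff forall_2 algebra_simps add_divide_distrib diff_divide_distrib)
  have half: "complex_of_real (sin (y $ 1)) = 2 * s * c" "complex_of_real (cos (y $ 1)) = c * c - s * s"
    "c * c + s * s = 1"
    unfolding sc by (rule sin_cos_half_angle)+
  \<comment> \<open>Multiplying by \<open>c * c + s * s = 1\<close> makes these terms cubic in
    \<open>c\<close> and \<open>s\<close>, like the right-hand sides of \<open>r\<close>, which then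
    follow by expanding \<open>q\<close> and \<open>q'\<close>.\<close>
  have "c * P + \<i> * s * Q = (c * c + s * s) * (c * P + \<i> * s * Q)"
    "c * Q + \<i> * s * P = (c * c + s * s) * (c * Q + \<i> * s * P)"
    by (simp_all add: half)
  then have r: "c * P + \<i> * s * Q = (c * c - s * s) * q + 2 * \<i> * s * c * q'"
    "c * Q + \<i> * s * P = (c * c - s * s) * q' + 2 * \<i> * s * c * q"
    unfolding q by (simp_all add: algebra_simps)
  \<comment> \<open>The matrix \<open>K\<close> in \<open>\<theta>\<close> satisfies \<open>K \<sigma>\<^sub>3 = (cos \<theta> \<sigma>\<^sub>3 - sin \<theta> \<sigma>\<^sub>2) K\<close>, so the division by \<open>sin \<theta>\<close> cancels.\<close>
  have "?d 2 - of_real (cos (y $ 1)) *s ?d 3 = of_real (sin (y $ 1)) *s G"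
    unfolding d r G_def half
    by (simp add: vec_eq_iff forall_2 algebra_simps add_divide_distrib diff_divide_distrib)
  note comb = scale_combination[OF this assms]
  define X Y where XY: "X = complex_of_real (cos (y $ 3))" "Y = complex_of_real (sin (y $ 3))"
  have rot: "X * u - \<i> * Y * u - v = 0" "X * v + \<i> * Y * v - u = 0"
    unfolding XY uv by (rule half_cis_rotate)+
  \<comment> \<open>A polynomial identity in \<open>q\<close>, \<open>q'\<close>, \<open>u\<close>,
    \<open>v\<close>, \<open>X\<close>, \<open>Y\<close>: the relation of the full angle in
    \<open>X\<close>, \<open>Y\<close> to the half angle in \<open>u\<close>, \<open>v\<close> is
    confined to the correction vector, which \<open>rot\<close> makes zero.\<close>
  have "of_real (- sin (y $ 3)) *s ?d 1 + X *s G = (-1/2) *s (gam 0 2 *v berger_spinor y C)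
      + vector [(X * v + \<i> * Y * v - u) * q / 2 - (X * u - \<i> * Y * u - v) * q' / 2,
                (X * v + \<i> * Y * v - u) * q / 2 + (X * u - \<i> * Y * u - v) * q' / 2]"
    unfolding d G_def F gam_mult of_real_minus XY(2)[symmetric]
    by (simp add: vec_eq_iff forall_2 algebra_simps add_divide_distrib diff_divide_distrib)
  also have "\<dots> = (-1/2) *s (gam 0 2 *v berger_spinor y C)"
    unfolding rot by (simp add: vec_eq_iff forall_2)
  \<comment> \<open>Grouping \<open>a + b - c\<close> as \<open>a + (b - c)\<close> exposes the part
    that \<open>comb\<close> replaces by a multiple of \<open>G\<close>.\<close>
  finally show ?e2
    unfolding add_diff_eq[symmetric] cot_def comb XY .
  have "X *s ?d 1 + Y *s G = (-1/2) *s (gam 0 3 *v berger_spinor y C)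
      - (\<i> / 2) *s vector [(X * v + \<i> * Y * v - u) * q + (X * u - \<i> * Y * u - v) * q',
                (X * v + \<i> * Y * v - u) * q - (X * u - \<i> * Y * u - v) * q']"
    unfolding d G_def F gam_mult
    by (simp add: vec_eq_iff forall_2 algebra_simps add_divide_distrib diff_divide_distrib)
  also have "\<dots> = (-1/2) *s (gam 0 3 *v berger_spinor y C)"
    unfolding rot by (simp add: vec_eq_iff forall_2)
  finally show ?e3
    unfolding add_diff_eq[symmetric] cot_def comb XY .
qed

text \<open>As for the sphere, with \<open>c * c - s * s = 1\<close> as normalisation. All three
  coefficients are now \<open>\<i>/2\<close>, matching the factor \<open>\<i> ^ r\<close> of the SqK
  equation for \<open>r = 1\<close>.\<close>

lemma lorentz_spinor_frame_deriv:
  assumes "sinh (y $ 1) \<noteq> 0"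
  shows "lorentz_spinor_deriv y C (axis 3 1) = (\<i>/2) *s (gam 1 1 *v lorentz_spinor y C)"
    and "of_real (cos (y $ 3)) *s lorentz_spinor_deriv y C (axis 1 1)
       + of_real (sin (y $ 3) / sinh (y $ 1)) *s lorentz_spinor_deriv y C (axis 2 1)
       - of_real (cosh (y $ 1) / sinh (y $ 1) * sin (y $ 3)) *s lorentz_spinor_deriv y C (axis 3 1)
       = (\<i>/2) *s (gam 1 2 *v lorentz_spinor y C)" (is ?e2)
    and "of_real (- sin (y $ 3)) *s lorentz_spinor_deriv y C (axis 1 1)
       + of_real (cos (y $ 3) / sinh (y $ 1)) *s lorentz_spinor_deriv y C (axis 2 1)
       - of_real (cosh (y $ 1) / sinh (y $ 1) * cos (y $ 3)) *s lorentz_spinor_deriv y C (axis 3 1)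
       = (\<i>/2) *s (gam 1 3 *v lorentz_spinor y C)" (is ?e3)
proof -
  let ?d = "\<lambda>k. lorentz_spinor_deriv y C (axis k 1)"
  define P Q where PQ: "P = half_cis (y $ 2) * C $ 1" "Q = half_cis (- (y $ 2)) * C $ 2"
  define s c where sc: "s = complex_of_real (sinh (y $ 1 / 2))" "c = complex_of_real (cosh (y $ 1 / 2))"
  define u v where uv: "u = half_cis (y $ 3)" "v = half_cis (- (y $ 3))"
  define q q' where q: "q = c * P - \<i> * s * Q" "q' = c * Q + \<i> * s * P"
  \<comment> \<open>Again a quotient, of \<open>?d 2 - cosh \<chi> *s ?d 3\<close> by
    \<open>sinh \<chi>\<close>.\<close>
  define G :: "complex^2" where "G = vector [- (u * q' + v * q) / 2, - (u * q' - v * q) / 2]"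
  have F: "lorentz_spinor y C = vector [u * q + v * q', u * q - v * q']"
    by (simp add: lorentz_spinor_eq PQ sc uv q Let_def)
  have d: "?d 1 = vector [\<i> / 2 * (v * q - u * q'), - \<i> / 2 * (u * q' + v * q)]"
    "?d 2 = vector [\<i> / 2 * (u * (c * P + \<i> * s * Q) + v * (\<i> * s * P - c * Q)),
                    \<i> / 2 * (u * (c * P + \<i> * s * Q) - v * (\<i> * s * P - c * Q))]"
    "?d 3 = vector [\<i> / 2 * (u * q - v * q'), \<i> / 2 * (u * q + v * q')]"
    by (simp_all add: lorentz_spinor_deriv_def PQ sc uv q axis_def Let_def vec_eq_iff forall_2 algebra_simps
        add_divide_distrib diff_divide_distrib)
  show "?d 3 = (\<i>/2) *s (gam 1 1 *v lorentz_spinor y C)"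
    unfolding d F
    by (simp add: gam_mult vec_eq_iff forall_2 algebra_simps add_divide_distrib diff_divide_distrib)
  have half: "complex_of_real (sinh (y $ 1)) = 2 * s * c" "complex_of_real (cosh (y $ 1)) = c * c + s * s"
    "c * c - s * s = 1"
    unfolding sc by (rule sinh_cosh_half_angle)+
  have "c * P + \<i> * s * Q = (c * c - s * s) * (c * P + \<i> * s * Q)"
    "\<i> * s * P - c * Q = (c * c - s * s) * (\<i> * s * P - c * Q)"
    by (simp_all add: half)
  then have r: "c * P + \<i> * s * Q = (c * c + s * s) * q + 2 * \<i> * s * c * q'"
    "\<i> * s * P - c * Q = 2 * \<i> * s * c * q - (c * c + s * s) * q'"
    unfolding q by (simp_all add: algebra_simps)
  \<comment> \<open>The matrix \<open>K\<close> in \<open>\<chi>\<close> satisfies \<open>K \<sigma>\<^sub>3 = (cosh \<chi> \<sigma>\<^sub>3 + \<i> sinh \<chi> \<sigma>\<^sub>1) K\<close>, so the division by \<open>sinh \<chi>\<close> cancels.\<close>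
  have "?d 2 - of_real (cosh (y $ 1)) *s ?d 3 = of_real (sinh (y $ 1)) *s G"
    unfolding d r G_def half
    by (simp add: vec_eq_iff forall_2 algebra_simps add_divide_distrib diff_divide_distrib)
  note comb = scale_combination[OF this assms]
  define X Y where XY: "X = complex_of_real (cos (y $ 3))" "Y = complex_of_real (sin (y $ 3))"
  have rot: "X * u - \<i> * Y * u - v = 0" "X * v + \<i> * Y * v - u = 0"
    unfolding XY uv by (rule half_cis_rotate)+
  have "X *s ?d 1 + Y *s G = (\<i>/2) *s (gam 1 2 *v lorentz_spinor y C)
      + (\<i> / 2) *s vector [(X * v + \<i> * Y * v - u) * q - (X * u - \<i> * Y * u - v) * q',
                - (X * v + \<i> * Y * v - u) * q - (X * u - \<i> * Y * u - v) * q']"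
    unfolding d G_def F One_nat_def gam_mult
    by (simp add: vec_eq_iff forall_2 algebra_simps add_divide_distrib diff_divide_distrib)
  also have "\<dots> = (\<i>/2) *s (gam 1 2 *v lorentz_spinor y C)"
    unfolding rot by (simp add: vec_eq_iff forall_2)
  finally show ?e2
    unfolding add_diff_eq[symmetric] comb XY .
  have "of_real (- sin (y $ 3)) *s ?d 1 + X *s G = (\<i>/2) *s (gam 1 3 *v lorentz_spinor y C)
      - (1 / 2) *s vector [(X * v + \<i> * Y * v - u) * q + (X * u - \<i> * Y * u - v) * q',
                (X * u - \<i> * Y * u - v) * q' - (X * v + \<i> * Y * v - u) * q]"
    unfolding d G_def F One_nat_def gam_mult of_real_minus XY(2)[symmetric]
    by (simp add: vec_eq_iff forall_2 algebra_simps add_divide_distrib diff_divide_distrib)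
  also have "\<dots> = (\<i>/2) *s (gam 1 3 *v lorentz_spinor y C)"
    unfolding rot by (simp add: vec_eq_iff forall_2)
  finally show ?e3
    unfolding add_diff_eq[symmetric] comb XY .
qed

section \<open>Lengths of the explicit spinors\<close>

text \<open>The two inner matrix factors are unitary, and the outer one is \<open>sqrt 2\<close>
  times a unitary matrix, whence the factor 2.\<close>

lemma spin_inner_berger:
  "spin_inner 0 (berger_spinor y C) (berger_spinor y C) = of_real (2 * ((cmod (C $ 1))\<^sup>2 + (cmod (C $ 2))\<^sup>2))"
proof -
  define P Q where PQ: "P = half_cis (y $ 2) * C $ 1" "Q = half_cis (- (y $ 2)) * C $ 2"
  define s c where sc: "s = complex_of_real (sin (y $ 1 / 2))" "c = complex_of_real (cos (y $ 1 / 2))"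
  define u v where uv: "u = half_cis (y $ 3)" "v = half_cis (- (y $ 3))"
  define q q' where q: "q = c * P - \<i> * s * Q" "q' = c * Q - \<i> * s * P"
  have F: "berger_spinor y C = vector [u * q + v * q', v * q' - u * q]"
    by (simp add: berger_spinor_eq PQ sc uv q Let_def)
  have cnj: "cnj u = v" "cnj v = u"
    and cnj_q: "cnj q = c * cnj P + \<i> * s * cnj Q" "cnj q' = c * cnj Q + \<i> * s * cnj P"
    by (simp_all add: sc uv q half_cis_eq_cis cis_cnj)
  have "spin_inner 0 (berger_spinor y C) (berger_spinor y C) = 2 * (u * v) * (cnj q * q + cnj q' * q')"
    unfolding F by (simp add: spin_inner_def sum_2 cnj algebra_simps)
  also have "\<dots> = 2 * (u * v) * ((c * c + s * s) * (P * cnj P + Q * cnj Q))"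
    unfolding cnj_q by (simp add: q algebra_simps)
  also have "\<dots> = of_real (2 * ((cmod P)\<^sup>2 + (cmod Q)\<^sup>2))"
    unfolding of_real_mult of_real_add complex_norm_square
    by (simp add: uv sc half_cis_inverse sin_cos_half_angle(3))
  finally show ?thesis by (simp add: PQ norm_mult half_cis_eq_cis)
qed

text \<open>The outer matrix carries the form given by \<open>gam 1 1\<close> into twice the form of
  signature (1,1) in diagonal shape, which the inner factors preserve, the middle one because
  \<open>c * c - s * s = 1\<close>.\<close>

lemma spin_inner_lorentz:
  "spin_inner 1 (lorentz_spinor y C) (lorentz_spinor y C) = of_real (2 * ((cmod (C $ 1))\<^sup>2 - (cmod (C $ 2))\<^sup>2))"
proof -
  define P Q where PQ: "P = half_cis (y $ 2) * C $ 1" "Q = half_cis (- (y $ 2)) * C $ 2"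
  define s c where sc: "s = complex_of_real (sinh (y $ 1 / 2))" "c = complex_of_real (cosh (y $ 1 / 2))"
  define u v where uv: "u = half_cis (y $ 3)" "v = half_cis (- (y $ 3))"
  define q q' where q: "q = c * P - \<i> * s * Q" "q' = c * Q + \<i> * s * P"
  have F: "lorentz_spinor y C = vector [u * q + v * q', u * q - v * q']"
    by (simp add: lorentz_spinor_eq PQ sc uv q Let_def)
  have cnj: "cnj u = v" "cnj v = u"
    and cnj_q: "cnj q = c * cnj P + \<i> * s * cnj Q" "cnj q' = c * cnj Q - \<i> * s * cnj P"
    by (simp_all add: sc uv q half_cis_eq_cis cis_cnj)
  have "spin_inner 1 (lorentz_spinor y C) (lorentz_spinor y C) = 2 * (u * v) * (cnj q * q - cnj q' * q')"
    unfolding F by (simp add: spin_inner_def sum_2 gam_mult cnj algebra_simps)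
  also have "\<dots> = 2 * (u * v) * ((c * c - s * s) * (P * cnj P - Q * cnj Q))"
    unfolding cnj_q by (simp add: q algebra_simps)
  also have "\<dots> = of_real (2 * ((cmod P)\<^sup>2 - (cmod Q)\<^sup>2))"
    unfolding of_real_mult of_real_diff complex_norm_square
    by (simp add: uv sc half_cis_inverse sinh_cosh_half_angle(3))
  finally show ?thesis by (simp add: PQ norm_mult half_cis_eq_cis)
qed

text \<open>Both matrices are unitary, and in the Lorentzian case \<open>gam 1 1\<close> commutes
  with the matrix of the form, being that matrix. So Clifford multiplication by \<open>\<xi>\<close>
  preserves lengths.\<close>

lemma spin_inner_gam_1:
  "spin_inner 0 (gam 0 1 *v s) (gam 0 1 *v s) = spin_inner 0 s s"
  "spin_inner 1 (gam 1 1 *v s) (gam 1 1 *v s) = spin_inner 1 s s"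
proof -
  have "\<i> * cnj a * (\<i> * a) = - (cnj a * a)" for a
    by (simp add: algebra_simps)
  then show "spin_inner 0 (gam 0 1 *v s) (gam 0 1 *v s) = spin_inner 0 s s"
    by (simp add: spin_inner_def sum_2 gam_mult)
  show "spin_inner 1 (gam 1 1 *v s) (gam 1 1 *v s) = spin_inner 1 s s"
    by (simp add: spin_inner_def sum_2 gam_mult)
qed

section \<open>From coordinate derivatives to SqK-spinors\<close>

lemma matrix_mult_smooth_deriv:
  fixes M :: "complex^2^2"
  shows "open S \<Longrightarrow> (\<And>i. csmooth_on S (\<lambda>y. F y $ i)) \<Longrightarrow> csmooth_on S (\<lambda>y. (M *v F y) $ i)"
    and "(\<And>i. ((\<lambda>y. F y $ i) has_derivative (\<lambda>h. F' h $ i)) (at y)) \<Longrightarrow>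
      ((\<lambda>y. (M *v F y) $ i) has_derivative (\<lambda>h. (M *v F' h) $ i)) (at y)"
  unfolding matrix_vector_mult_def sum_2
  by (simp_all add: csmooth_on_add csmooth_on_mult csmooth_on_const has_derivative_add
      has_derivative_mult_right)

text \<open>Moving the constant matrix \<open>gam r 1\<close> past \<open>gam r j\<close> flips the
  sign of the coefficient, so the frame equation of an explicit spinor yields that of its Clifford
  product with \<open>\<xi>\<close>.\<close>

lemma gam_1_combination:
  assumes "a *s X + b *s Y - c *s Z = k *s (gam r j *v s)" "r \<le> 1" "j \<noteq> 1"
  shows "a *s (gam r 1 *v X) + b *s (gam r 1 *v Y) - c *s (gam r 1 *v Z)
    = (- k) *s (gam r j *v (gam r 1 *v s))"
proof -
  have "a *s (gam r 1 *v X) + b *s (gam r 1 *v Y) - c *s (gam r 1 *v Z)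
      = gam r 1 *v (a *s X + b *s Y - c *s Z)"
    by (simp add: matrix_vector_mult_diff_distrib matrix_vector_right_distrib vector_scalar_commute)
  also have "\<dots> = (- k) *s (gam r j *v (gam r 1 *v s))"
    unfolding assms(1) vector_scalar_commute gam_1_anticomm[OF assms(2,3)]
    by (simp add: vec_eq_iff)
  finally show ?thesis .
qed

text \<open>Stated for a general \<open>F\<close>, since both explicit spinors satisfy such
  equations and differ only in \<open>k = -1/2\<close> or \<open>k = 1/2\<close>. The prefactor
  \<open>2 / sqrt \<alpha>\<close> takes \<open>k\<close> to \<open>a - 1/2\<close>, while
  \<open>2 / \<alpha>\<close> gives \<open>l = - 1 / \<alpha>\<close> in both cases, which fixes
  \<open>a + b\<close>.\<close>

lemma sqk_spinor_on_berger:
  assumes frame: "sasakian_frame 0 A \<xi> g H e" and sm: "smooth_structure A"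
    and eta: "one_form A \<eta>" "\<And>p j. \<eta> p (e j p) = (if j = 1 then 1 else 0)"
    and H: "H = 4 / \<alpha> - 3" and coord: "berger_coordinates A g e \<alpha> c"
    and smooth: "\<And>S i. open S \<Longrightarrow> csmooth_on S (\<lambda>y. F y $ i)"
    and der: "\<And>y i. ((\<lambda>y. F y $ i) has_derivative (\<lambda>h. F' y h $ i)) (at y)"
    and d1: "\<And>y. sin (y $ 1) \<noteq> 0 \<Longrightarrow> F' y (axis 3 1) = (-1/2) *s (gam 0 1 *v F y)"
    and d2: "\<And>y. sin (y $ 1) \<noteq> 0 \<Longrightarrow> of_real (- sin (y $ 3)) *s F' y (axis 1 1)
       + of_real (cos (y $ 3) / sin (y $ 1)) *s F' y (axis 2 1)
       - of_real (cot (y $ 1) * cos (y $ 3)) *s F' y (axis 3 1) = of_real k *s (gam 0 2 *v F y)"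
    and d3: "\<And>y. sin (y $ 1) \<noteq> 0 \<Longrightarrow> of_real (cos (y $ 3)) *s F' y (axis 1 1)
       + of_real (sin (y $ 3) / sin (y $ 1)) *s F' y (axis 2 1)
       - of_real (cot (y $ 1) * sin (y $ 3)) *s F' y (axis 3 1) = of_real k *s (gam 0 3 *v F y)"
    and a: "a = 1 / 2 + 2 / sqrt \<alpha> * k" and b: "a + b = - 1 / 2"
  shows "sqk_spinor_on 0 A \<xi> \<eta> H e (fst c) a b (\<lambda>p. F (snd c p))"
proof -
  obtain U x where c: "c = (U, x)" by (cases c)
  have cA: "(U, x) \<in> A" using coord c by (simp add: berger_coordinates_def)
  have ch: "is_chart (U, x)" using sm cA unfolding smooth_structure_def by blast
  note D = dir_deriv_coord_vector[OF cA ch _ smooth[OF chart_open_image[OF ch]] der]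
  have e: "e 1 p = (\<lambda>f. 2 / \<alpha> * coord_vector A (U, x) 3 p f)"
      "e 2 p = (\<lambda>f. 2 / sqrt \<alpha> * (- sin (x p $ 3) * coord_vector A (U, x) 1 p f
        + cos (x p $ 3) / sin (x p $ 1) * coord_vector A (U, x) 2 p f
        - cot (x p $ 1) * cos (x p $ 3) * coord_vector A (U, x) 3 p f))"
      "e 3 p = (\<lambda>f. 2 / sqrt \<alpha> * (cos (x p $ 3) * coord_vector A (U, x) 1 p f
        + sin (x p $ 3) / sin (x p $ 1) * coord_vector A (U, x) 2 p f
        - cot (x p $ 1) * sin (x p $ 3) * coord_vector A (U, x) 3 p f))"
    and s0: "sin (x p $ 1) \<noteq> 0" if "p \<in> U" for p
    using coord that sin_gt_zero[of "x p $ 1"] unfolding berger_coordinates_def c Let_def by auto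
  show ?thesis
    unfolding c fst_conv snd_conv
  proof (rule sqk_spinor_on_frameI[OF frame, where k="of_real (2 / sqrt \<alpha> * k)" and l="of_real (- 1 / \<alpha>)"])
    show "spinor_field_on A U (\<lambda>p. F (x p))"
      by (rule spinor_field_on_chart[OF cA ch smooth[OF chart_open_image[OF ch]]])
    show "dir_deriv (e 1 p) (\<lambda>p. F (x p)) = of_real (- 1 / \<alpha>) *s (gam 0 1 *v F (x p))" if "p \<in> U" for p
      unfolding e[OF that] dir_deriv_combination D[OF that] d1[OF s0[OF that]]
      by (simp add: vec_eq_iff)
    show "dir_deriv (e 2 p) (\<lambda>p. F (x p)) = of_real (2 / sqrt \<alpha> * k) *s (gam 0 2 *v F (x p))" if "p \<in> U" for p
      unfolding e[OF that] dir_deriv_combination D[OF that] d2[OF s0[OF that]]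
      by (simp add: vector_smult_assoc)
    show "dir_deriv (e 3 p) (\<lambda>p. F (x p)) = of_real (2 / sqrt \<alpha> * k) *s (gam 0 3 *v F (x p))" if "p \<in> U" for p
      unfolding e[OF that] dir_deriv_combination D[OF that] d3[OF s0[OF that]]
      by (simp add: vector_smult_assoc)
    \<comment> \<open>Here \<open>(- 1) powi (- 1) = - 1\<close> and
      \<open>(H - 1) / 4 = 1 / \<alpha> - 1\<close>.\<close>
    show "of_real (- 1 / \<alpha>) = complex_of_real (a + b) * \<i> ^ 0 - (- \<i>) ^ 0 / 2
        - \<i> ^ 0 * ((complex_of_real H + (- 1) powi (int 0 - 1)) / 4)"
      unfolding b H by (simp add: power_int_minus complex_eq_iff diff_divide_distrib)
    show "of_real (2 / sqrt \<alpha> * k) = complex_of_real a * \<i> ^ 0 - (- \<i>) ^ 0 / 2"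
      unfolding a by (simp add: complex_eq_iff)
  qed (fact eta)+
qed

text \<open>The factor \<open>\<i>\<close> is split off the coefficients, so that \<open>k\<close>
  is real and determines the real number \<open>a\<close>.\<close>

lemma sqk_spinor_on_lorentz:
  assumes frame: "sasakian_frame 1 A \<xi> g H e" and sm: "smooth_structure A"
    and eta: "one_form A \<eta>" "\<And>p j. \<eta> p (e j p) = (if j = 1 then 1 else 0)"
    and H: "H = - 4 / \<alpha> + 3" and coord: "lorentz_coordinates A g e \<alpha> c"
    and smooth: "\<And>S i. open S \<Longrightarrow> csmooth_on S (\<lambda>y. F y $ i)"
    and der: "\<And>y i. ((\<lambda>y. F y $ i) has_derivative (\<lambda>h. F' y h $ i)) (at y)"
    and d1: "\<And>y. sinh (y $ 1) \<noteq> 0 \<Longrightarrow> F' y (axis 3 1) = (\<i>/2) *s (gam 1 1 *v F y)"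
    and d2: "\<And>y. sinh (y $ 1) \<noteq> 0 \<Longrightarrow> of_real (cos (y $ 3)) *s F' y (axis 1 1)
       + of_real (sin (y $ 3) / sinh (y $ 1)) *s F' y (axis 2 1)
       - of_real (cosh (y $ 1) / sinh (y $ 1) * sin (y $ 3)) *s F' y (axis 3 1)
       = (of_real k * \<i>) *s (gam 1 2 *v F y)"
    and d3: "\<And>y. sinh (y $ 1) \<noteq> 0 \<Longrightarrow> of_real (- sin (y $ 3)) *s F' y (axis 1 1)
       + of_real (cos (y $ 3) / sinh (y $ 1)) *s F' y (axis 2 1)
       - of_real (cosh (y $ 1) / sinh (y $ 1) * cos (y $ 3)) *s F' y (axis 3 1)
       = (of_real k * \<i>) *s (gam 1 3 *v F y)"
    and a: "a = - 1 / 2 + 2 / sqrt \<alpha> * k" and b: "a + b = 1 / 2"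
  shows "sqk_spinor_on 1 A \<xi> \<eta> H e (fst c) a b (\<lambda>p. F (snd c p))"
proof -
  obtain U x where c: "c = (U, x)" by (cases c)
  have cA: "(U, x) \<in> A" using coord c by (simp add: lorentz_coordinates_def)
  have ch: "is_chart (U, x)" using sm cA unfolding smooth_structure_def by blast
  note D = dir_deriv_coord_vector[OF cA ch _ smooth[OF chart_open_image[OF ch]] der]
  have e: "e 1 p = (\<lambda>f. 2 / \<alpha> * coord_vector A (U, x) 3 p f)"
      "e 2 p = (\<lambda>f. 2 / sqrt \<alpha> * (cos (x p $ 3) * coord_vector A (U, x) 1 p f
        + sin (x p $ 3) / sinh (x p $ 1) * coord_vector A (U, x) 2 p f
        - cosh (x p $ 1) / sinh (x p $ 1) * sin (x p $ 3) * coord_vector A (U, x) 3 p f))"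
      "e 3 p = (\<lambda>f. 2 / sqrt \<alpha> * (- sin (x p $ 3) * coord_vector A (U, x) 1 p f
        + cos (x p $ 3) / sinh (x p $ 1) * coord_vector A (U, x) 2 p f
        - cosh (x p $ 1) / sinh (x p $ 1) * cos (x p $ 3) * coord_vector A (U, x) 3 p f))"
    and s0: "sinh (x p $ 1) \<noteq> 0" if "p \<in> U" for p
    using coord that unfolding lorentz_coordinates_def c Let_def by auto
  show ?thesis
    unfolding c fst_conv snd_conv
  proof (rule sqk_spinor_on_frameI[OF frame, where k="of_real (2 / sqrt \<alpha> * k) * \<i>" and l="of_real (1 / \<alpha>) * \<i>"])
    show "spinor_field_on A U (\<lambda>p. F (x p))"
      by (rule spinor_field_on_chart[OF cA ch smooth[OF chart_open_image[OF ch]]])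
    show "dir_deriv (e 1 p) (\<lambda>p. F (x p)) = (of_real (1 / \<alpha>) * \<i>) *s (gam 1 1 *v F (x p))" if "p \<in> U" for p
      unfolding e[OF that] dir_deriv_combination D[OF that] d1[OF s0[OF that]]
      by (simp add: vec_eq_iff)
    show "dir_deriv (e 2 p) (\<lambda>p. F (x p)) = (of_real (2 / sqrt \<alpha> * k) * \<i>) *s (gam 1 2 *v F (x p))" if "p \<in> U" for p
      unfolding e[OF that] dir_deriv_combination D[OF that] d2[OF s0[OF that]]
      by (simp add: vector_smult_assoc)
    show "dir_deriv (e 3 p) (\<lambda>p. F (x p)) = (of_real (2 / sqrt \<alpha> * k) * \<i>) *s (gam 1 3 *v F (x p))" if "p \<in> U" for p
      unfolding e[OF that] dir_deriv_combination D[OF that] d3[OF s0[OF that]]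
      by (simp add: vector_smult_assoc)
    \<comment> \<open>Here the exponent of \<open>- 1\<close> is 0 and
      \<open>(H + 1) / 4 = 1 - 1 / \<alpha>\<close>.\<close>
    show "of_real (1 / \<alpha>) * \<i> = complex_of_real (a + b) * \<i> ^ 1 - (- \<i>) ^ 1 / 2
        - \<i> ^ 1 * ((complex_of_real H + (- 1) powi (int 1 - 1)) / 4)"
      unfolding b H by (simp add: complex_eq_iff diff_divide_distrib)
    show "of_real (2 / sqrt \<alpha> * k) * \<i> = complex_of_real a * \<i> ^ 1 - (- \<i>) ^ 1 / 2"
      unfolding a by (simp add: complex_eq_iff)
  qed (fact eta)+
qed

lemma sqk_spinors_riemannian:
  fixes A :: "'a::{t2_space,second_countable_topology} atlas"
  assumes sf: "sasakian_space_form A \<phi> \<xi> \<eta> g H" and frame: "sasakian_frame 0 A \<xi> g H e"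
  shows "sqk_spinor_on 0 A \<xi> \<eta> H e UNIV (1/2) ((H - 1) / 4) (\<lambda>p. vector [C1, C2])"
    and "H = 4 / \<alpha> - 3 \<Longrightarrow> berger_coordinates A g e \<alpha> c \<Longrightarrow>
      sqk_spinor_on 0 A \<xi> \<eta> H e (fst c) ((1 - sqrt (3 + H)) / 2) ((-2 + sqrt (3 + H)) / 2)
        (\<lambda>p. berger_spinor (snd c p) C)"
    and "H = 4 / \<alpha> - 3 \<Longrightarrow> berger_coordinates A g e \<alpha> c \<Longrightarrow>
      sqk_spinor_on 0 A \<xi> \<eta> H e (fst c) ((1 + sqrt (3 + H)) / 2) ((-2 - sqrt (3 + H)) / 2)
        (\<lambda>p. gam 0 1 *v berger_spinor (snd c p) C)"
proof -
  have sas: "sasakian A \<phi> \<xi> \<eta> g" using sf by (simp add: sasakian_space_form_def)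
  then have sm: "smooth_structure A" and one: "one_form A \<eta>"
    by (simp_all add: sasakian_def contact_metric_def)
  note eta = one one_form_frame_riemannian[OF sas frame]
  show "sqk_spinor_on 0 A \<xi> \<eta> H e UNIV (1/2) ((H - 1) / 4) (\<lambda>p. vector [C1, C2])"
    by (rule sqk_spinor_const[OF frame sm]) (simp_all add: eta power_int_minus)
  assume H: "H = 4 / \<alpha> - 3" and coord: "berger_coordinates A g e \<alpha> c"
  \<comment> \<open>For \<open>k = -1/2\<close> and \<open>k = 1/2\<close> this identifies
    \<open>2 / sqrt \<alpha> * k\<close> with the terms \<open>- sqrt (3 + H) / 2\<close> and
    \<open>sqrt (3 + H) / 2\<close> of the two types.\<close>
  have sq: "sqrt (3 + H) = 2 / sqrt \<alpha>" by (simp add: H real_sqrt_divide)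
  note I = sqk_spinor_on_berger[OF frame sm _ _ H coord]
  show "sqk_spinor_on 0 A \<xi> \<eta> H e (fst c) ((1 - sqrt (3 + H)) / 2) ((-2 + sqrt (3 + H)) / 2)
        (\<lambda>p. berger_spinor (snd c p) C)"
  proof (rule I[where F="\<lambda>y. berger_spinor y C" and F'="\<lambda>y. berger_spinor_deriv y C" and k="-1/2"])
    fix y :: "real^3" assume y: "sin (y $ 1) \<noteq> 0"
    note d = berger_spinor_frame_deriv[OF y, of C]
    show "berger_spinor_deriv y C (axis 3 1) = (-1/2) *s (gam 0 1 *v berger_spinor y C)" by (rule d)
    show "of_real (- sin (y $ 3)) *s berger_spinor_deriv y C (axis 1 1)
       + of_real (cos (y $ 3) / sin (y $ 1)) *s berger_spinor_deriv y C (axis 2 1)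
       - of_real (cot (y $ 1) * cos (y $ 3)) *s berger_spinor_deriv y C (axis 3 1)
       = of_real (-1/2) *s (gam 0 2 *v berger_spinor y C)"
      unfolding d(2) by simp
    show "of_real (cos (y $ 3)) *s berger_spinor_deriv y C (axis 1 1)
       + of_real (sin (y $ 3) / sin (y $ 1)) *s berger_spinor_deriv y C (axis 2 1)
       - of_real (cot (y $ 1) * sin (y $ 3)) *s berger_spinor_deriv y C (axis 3 1)
       = of_real (-1/2) *s (gam 0 3 *v berger_spinor y C)"
      unfolding d(3) by simp
  qed (fact eta berger_spinor_has_derivative csmooth_on_berger_spinor | (unfold sq, simp add: field_simps; fail) | (unfold sq, linarith))+
  show "sqk_spinor_on 0 A \<xi> \<eta> H e (fst c) ((1 + sqrt (3 + H)) / 2) ((-2 - sqrt (3 + H)) / 2)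
        (\<lambda>p. gam 0 1 *v berger_spinor (snd c p) C)"
  proof (rule I[where F="\<lambda>y. gam 0 1 *v berger_spinor y C"
        and F'="\<lambda>y h. gam 0 1 *v berger_spinor_deriv y C h" and k="1/2"])
    fix y :: "real^3" assume y: "sin (y $ 1) \<noteq> 0"
    note d = berger_spinor_frame_deriv[OF y, of C]
    show "gam 0 1 *v berger_spinor_deriv y C (axis 3 1) = (-1/2) *s (gam 0 1 *v (gam 0 1 *v berger_spinor y C))"
      \<comment> \<open>\<open>gam 0 1\<close> commutes with itself, so the equation along
        \<open>e 1\<close> keeps its coefficient.\<close>
      unfolding d by (rule vector_scalar_commute)
    show "of_real (- sin (y $ 3)) *s (gam 0 1 *v berger_spinor_deriv y C (axis 1 1))
       + of_real (cos (y $ 3) / sin (y $ 1)) *s (gam 0 1 *v berger_spinor_deriv y C (axis 2 1))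
       - of_real (cot (y $ 1) * cos (y $ 3)) *s (gam 0 1 *v berger_spinor_deriv y C (axis 3 1))
       = of_real (1/2) *s (gam 0 2 *v (gam 0 1 *v berger_spinor y C))"
      by (subst gam_1_combination[OF d(2)]) simp_all
    show "of_real (cos (y $ 3)) *s (gam 0 1 *v berger_spinor_deriv y C (axis 1 1))
       + of_real (sin (y $ 3) / sin (y $ 1)) *s (gam 0 1 *v berger_spinor_deriv y C (axis 2 1))
       - of_real (cot (y $ 1) * sin (y $ 3)) *s (gam 0 1 *v berger_spinor_deriv y C (axis 3 1))
       = of_real (1/2) *s (gam 0 3 *v (gam 0 1 *v berger_spinor y C))"
      by (subst gam_1_combination[OF d(3)]) simp_all
  qed (fact eta | intro matrix_mult_smooth_deriv berger_spinor_has_derivative csmooth_on_berger_spinor; assumption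
      | (unfold sq, simp add: field_simps; fail) | (unfold sq, linarith))+
qed

lemma sqk_spinors_lorentzian:
  fixes A :: "'a::{t2_space,second_countable_topology} atlas"
  assumes sf: "lorentzian_sasakian_space_form A \<phi> \<xi> \<eta> g H" and frame: "sasakian_frame 1 A \<xi> g H e"
  shows "sqk_spinor_on 1 A \<xi> \<eta> H e UNIV (-1/2) ((H + 1) / 4) (\<lambda>p. vector [C1, C2])"
    and "H = - 4 / \<alpha> + 3 \<Longrightarrow> lorentz_coordinates A g e \<alpha> c \<Longrightarrow>
      sqk_spinor_on 1 A \<xi> \<eta> H e (fst c) ((-1 + sqrt (- H + 3)) / 2) ((2 - sqrt (- H + 3)) / 2)
        (\<lambda>p. lorentz_spinor (snd c p) C)"
    and "H = - 4 / \<alpha> + 3 \<Longrightarrow> lorentz_coordinates A g e \<alpha> c \<Longrightarrow>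
      sqk_spinor_on 1 A \<xi> \<eta> H e (fst c) ((-1 - sqrt (- H + 3)) / 2) ((2 + sqrt (- H + 3)) / 2)
        (\<lambda>p. gam 1 1 *v lorentz_spinor (snd c p) C)"
proof -
  have sas: "lorentzian_sasakian A \<phi> \<xi> \<eta> g" using sf by (simp add: lorentzian_sasakian_space_form_def)
  then have sm: "smooth_structure A" and one: "one_form A \<eta>"
    by (simp_all add: lorentzian_sasakian_def sasakian_def contact_metric_def)
  note eta = one one_form_frame_lorentzian[OF sas frame]
  show "sqk_spinor_on 1 A \<xi> \<eta> H e UNIV (-1/2) ((H + 1) / 4) (\<lambda>p. vector [C1, C2])"
    by (rule sqk_spinor_const[OF frame sm]) (simp_all add: eta)
  assume H: "H = - 4 / \<alpha> + 3" and coord: "lorentz_coordinates A g e \<alpha> c"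
  \<comment> \<open>In this signature the explicit spinor has \<open>k = 1/2\<close>, hence the plus
    type, and its Clifford product with \<open>\<xi>\<close> the minus type, opposite to the
    sphere.\<close>
  have sq: "sqrt (- H + 3) = 2 / sqrt \<alpha>" by (simp add: H real_sqrt_divide)
  note I = sqk_spinor_on_lorentz[OF frame sm _ _ H coord]
  show "sqk_spinor_on 1 A \<xi> \<eta> H e (fst c) ((-1 + sqrt (- H + 3)) / 2) ((2 - sqrt (- H + 3)) / 2)
        (\<lambda>p. lorentz_spinor (snd c p) C)"
  proof (rule I[where F="\<lambda>y. lorentz_spinor y C" and F'="\<lambda>y. lorentz_spinor_deriv y C" and k="1/2"])
    fix y :: "real^3" assume y: "sinh (y $ 1) \<noteq> 0"
    note d = lorentz_spinor_frame_deriv[OF y, of C]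
    show "lorentz_spinor_deriv y C (axis 3 1) = (\<i>/2) *s (gam 1 1 *v lorentz_spinor y C)" by (rule d)
    show "of_real (cos (y $ 3)) *s lorentz_spinor_deriv y C (axis 1 1)
       + of_real (sin (y $ 3) / sinh (y $ 1)) *s lorentz_spinor_deriv y C (axis 2 1)
       - of_real (cosh (y $ 1) / sinh (y $ 1) * sin (y $ 3)) *s lorentz_spinor_deriv y C (axis 3 1)
       = (of_real (1/2) * \<i>) *s (gam 1 2 *v lorentz_spinor y C)"
      unfolding d(2) by simp
    show "of_real (- sin (y $ 3)) *s lorentz_spinor_deriv y C (axis 1 1)
       + of_real (cos (y $ 3) / sinh (y $ 1)) *s lorentz_spinor_deriv y C (axis 2 1)
       - of_real (cosh (y $ 1) / sinh (y $ 1) * cos (y $ 3)) *s lorentz_spinor_deriv y C (axis 3 1)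
       = (of_real (1/2) * \<i>) *s (gam 1 3 *v lorentz_spinor y C)"
      unfolding d(3) by simp
  qed (fact eta lorentz_spinor_has_derivative csmooth_on_lorentz_spinor | (unfold sq, simp add: field_simps; fail) | (unfold sq, linarith))+
  show "sqk_spinor_on 1 A \<xi> \<eta> H e (fst c) ((-1 - sqrt (- H + 3)) / 2) ((2 + sqrt (- H + 3)) / 2)
        (\<lambda>p. gam 1 1 *v lorentz_spinor (snd c p) C)"
  proof (rule I[where F="\<lambda>y. gam 1 1 *v lorentz_spinor y C"
        and F'="\<lambda>y h. gam 1 1 *v lorentz_spinor_deriv y C h" and k="-1/2"])
    fix y :: "real^3" assume y: "sinh (y $ 1) \<noteq> 0"
    note d = lorentz_spinor_frame_deriv[OF y, of C]
    show "gam 1 1 *v lorentz_spinor_deriv y C (axis 3 1) = (\<i>/2) *s (gam 1 1 *v (gam 1 1 *v lorentz_spinor y C))"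
      unfolding d by (rule vector_scalar_commute)
    show "of_real (cos (y $ 3)) *s (gam 1 1 *v lorentz_spinor_deriv y C (axis 1 1))
       + of_real (sin (y $ 3) / sinh (y $ 1)) *s (gam 1 1 *v lorentz_spinor_deriv y C (axis 2 1))
       - of_real (cosh (y $ 1) / sinh (y $ 1) * sin (y $ 3)) *s (gam 1 1 *v lorentz_spinor_deriv y C (axis 3 1))
       = (of_real (-1/2) * \<i>) *s (gam 1 2 *v (gam 1 1 *v lorentz_spinor y C))"
      by (subst gam_1_combination[OF d(2)]) simp_all
    show "of_real (- sin (y $ 3)) *s (gam 1 1 *v lorentz_spinor_deriv y C (axis 1 1))
       + of_real (cos (y $ 3) / sinh (y $ 1)) *s (gam 1 1 *v lorentz_spinor_deriv y C (axis 2 1))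
       - of_real (cosh (y $ 1) / sinh (y $ 1) * cos (y $ 3)) *s (gam 1 1 *v lorentz_spinor_deriv y C (axis 3 1))
       = (of_real (-1/2) * \<i>) *s (gam 1 3 *v (gam 1 1 *v lorentz_spinor y C))"
      by (subst gam_1_combination[OF d(3)]) simp_all
  qed (fact eta | intro matrix_mult_smooth_deriv lorentz_spinor_has_derivative csmooth_on_lorentz_spinor; assumption
      | (unfold sq, simp add: field_simps; fail) | (unfold sq, linarith))+
qed

theorem proposition5p1:
  fixes A :: "'a::{t2_space,second_countable_topology} atlas"
    and \<phi> :: "'a endo" and \<xi> :: "'a vfield" and \<eta> :: "'a form1" and g :: "'a form2"
    and H :: real and e :: "3 \<Rightarrow> 'a vfield"
  shows
    "(sasakian_space_form A \<phi> \<xi> \<eta> g H \<and> sasakian_frame 0 A \<xi> g H e \<longrightarrow>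
       (\<forall>C1 C2 :: complex.
          sqk_spinor_on 0 A \<xi> \<eta> H e UNIV (1/2) ((H - 1) / 4) (\<lambda>p. vector [C1, C2])) \<and>
       (H > -3 \<longrightarrow> (\<forall>\<alpha> c. \<alpha> > 0 \<and> H = 4 / \<alpha> - 3 \<and> berger_coordinates A g e \<alpha> c \<longrightarrow>
          (\<forall>C1 C2 :: complex. \<forall>\<psi>m \<psi>p.
             \<psi>m = (\<lambda>p. berger_spinor (snd c p) (vector [C1, C2])) \<and>
             \<psi>p = (\<lambda>p. clifford 0 e p (\<xi> p) (\<psi>m p)) \<longrightarrow>
             sqk_spinor_on 0 A \<xi> \<eta> H e (fst c)
               ((1 + sqrt (3 + H)) / 2) ((-2 - sqrt (3 + H)) / 2) \<psi>p \<and>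
             sqk_spinor_on 0 A \<xi> \<eta> H e (fst c)
               ((1 - sqrt (3 + H)) / 2) ((-2 + sqrt (3 + H)) / 2) \<psi>m \<and>
             (\<forall>p\<in>fst c.
                spin_inner 0 (\<psi>p p) (\<psi>p p) = complex_of_real (2 * ((cmod C1)\<^sup>2 + (cmod C2)\<^sup>2)) \<and>
                spin_inner 0 (\<psi>m p) (\<psi>m p) = complex_of_real (2 * ((cmod C1)\<^sup>2 + (cmod C2)\<^sup>2))))))) \<and>
     (lorentzian_sasakian_space_form A \<phi> \<xi> \<eta> g H \<and> sasakian_frame 1 A \<xi> g H e \<longrightarrow>
       (\<forall>C1 C2 :: complex.
          sqk_spinor_on 1 A \<xi> \<eta> H e UNIV (-1/2) ((H + 1) / 4) (\<lambda>p. vector [C1, C2])) \<and>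
       (H < 3 \<longrightarrow> (\<forall>\<alpha> c. \<alpha> > 0 \<and> H = - 4 / \<alpha> + 3 \<and> lorentz_coordinates A g e \<alpha> c \<longrightarrow>
          (\<forall>C1 C2 :: complex. \<forall>\<psi>m \<psi>p.
             \<psi>p = (\<lambda>p. lorentz_spinor (snd c p) (vector [C1, C2])) \<and>
             \<psi>m = (\<lambda>p. clifford 1 e p (\<xi> p) (\<psi>p p)) \<longrightarrow>
             sqk_spinor_on 1 A \<xi> \<eta> H e (fst c)
               ((-1 + sqrt (- H + 3)) / 2) ((2 - sqrt (- H + 3)) / 2) \<psi>p \<and>
             sqk_spinor_on 1 A \<xi> \<eta> H e (fst c)
               ((-1 - sqrt (- H + 3)) / 2) ((2 + sqrt (- H + 3)) / 2) \<psi>m \<and>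
             (\<forall>p\<in>fst c.
                spin_inner 1 (\<psi>p p) (\<psi>p p) = complex_of_real (2 * ((cmod C1)\<^sup>2 - (cmod C2)\<^sup>2)) \<and>
                spin_inner 1 (\<psi>m p) (\<psi>m p) = complex_of_real (2 * ((cmod C1)\<^sup>2 - (cmod C2)\<^sup>2)))))))"
proof (intro conjI impI allI)
  assume "sasakian_space_form A \<phi> \<xi> \<eta> g H \<and> sasakian_frame 0 A \<xi> g H e"
  then have sf: "sasakian_space_form A \<phi> \<xi> \<eta> g H" and frame: "sasakian_frame 0 A \<xi> g H e" by auto
  note R = sqk_spinors_riemannian[OF sf frame]
  show "sqk_spinor_on 0 A \<xi> \<eta> H e UNIV (1/2) ((H - 1) / 4) (\<lambda>p. vector [C1, C2])" for C1 C2
    by (rule R)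
  fix \<alpha> c C1 C2 \<psi>m \<psi>p
  assume "\<alpha> > 0 \<and> H = 4 / \<alpha> - 3 \<and> berger_coordinates A g e \<alpha> c"
    and psi: "\<psi>m = (\<lambda>p. berger_spinor (snd c p) (vector [C1, C2])) \<and>
      \<psi>p = (\<lambda>p. clifford 0 e p (\<xi> p) (\<psi>m p))"
  then have coord: "H = 4 / \<alpha> - 3" "berger_coordinates A g e \<alpha> c" by auto
  have m: "\<psi>m = (\<lambda>p. berger_spinor (snd c p) (vector [C1, C2]))" using psi by blast
  \<comment> \<open>The only nonzero coframe component of \<open>\<xi>\<close> is the first, so
    Clifford multiplication by it is a constant matrix.\<close>
  have p: "\<psi>p = (\<lambda>p. gam 0 1 *v berger_spinor (snd c p) (vector [C1, C2]))"
    using psi clifford_xi[OF frame] by simp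
  show "sqk_spinor_on 0 A \<xi> \<eta> H e (fst c) ((1 + sqrt (3 + H)) / 2) ((-2 - sqrt (3 + H)) / 2) \<psi>p"
    unfolding p by (rule R(3)[OF coord])
  show "sqk_spinor_on 0 A \<xi> \<eta> H e (fst c) ((1 - sqrt (3 + H)) / 2) ((-2 + sqrt (3 + H)) / 2) \<psi>m"
    unfolding m by (rule R(2)[OF coord])
  show "\<forall>p\<in>fst c.
      spin_inner 0 (\<psi>p p) (\<psi>p p) = complex_of_real (2 * ((cmod C1)\<^sup>2 + (cmod C2)\<^sup>2)) \<and>
      spin_inner 0 (\<psi>m p) (\<psi>m p) = complex_of_real (2 * ((cmod C1)\<^sup>2 + (cmod C2)\<^sup>2))"
    unfolding p m spin_inner_gam_1 spin_inner_berger vector_2 by simp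
next
  assume "lorentzian_sasakian_space_form A \<phi> \<xi> \<eta> g H \<and> sasakian_frame 1 A \<xi> g H e"
  then have sf: "lorentzian_sasakian_space_form A \<phi> \<xi> \<eta> g H" and frame: "sasakian_frame 1 A \<xi> g H e" by auto
  note L = sqk_spinors_lorentzian[OF sf frame]
  show "sqk_spinor_on 1 A \<xi> \<eta> H e UNIV (-1/2) ((H + 1) / 4) (\<lambda>p. vector [C1, C2])" for C1 C2
    by (rule L)
  fix \<alpha> c C1 C2 \<psi>m \<psi>p
  assume "\<alpha> > 0 \<and> H = - 4 / \<alpha> + 3 \<and> lorentz_coordinates A g e \<alpha> c"
    and psi: "\<psi>p = (\<lambda>p. lorentz_spinor (snd c p) (vector [C1, C2])) \<and>
      \<psi>m = (\<lambda>p. clifford 1 e p (\<xi> p) (\<psi>p p))"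
  then have coord: "H = - 4 / \<alpha> + 3" "lorentz_coordinates A g e \<alpha> c" by auto
  have p: "\<psi>p = (\<lambda>p. lorentz_spinor (snd c p) (vector [C1, C2]))" using psi by blast
  have m: "\<psi>m = (\<lambda>p. gam 1 1 *v lorentz_spinor (snd c p) (vector [C1, C2]))"
    using psi clifford_xi[OF frame] by simp
  show "sqk_spinor_on 1 A \<xi> \<eta> H e (fst c) ((-1 + sqrt (- H + 3)) / 2) ((2 - sqrt (- H + 3)) / 2) \<psi>p"
    unfolding p by (rule L(2)[OF coord])
  show "sqk_spinor_on 1 A \<xi> \<eta> H e (fst c) ((-1 - sqrt (- H + 3)) / 2) ((2 + sqrt (- H + 3)) / 2) \<psi>m"
    unfolding m by (rule L(3)[OF coord])
  show "\<forall>p\<in>fst c.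
      spin_inner 1 (\<psi>p p) (\<psi>p p) = complex_of_real (2 * ((cmod C1)\<^sup>2 - (cmod C2)\<^sup>2)) \<and>
      spin_inner 1 (\<psi>m p) (\<psi>m p) = complex_of_real (2 * ((cmod C1)\<^sup>2 - (cmod C2)\<^sup>2))"
    unfolding p m spin_inner_gam_1 spin_inner_lorentz vector_2 by simp
qed

end
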